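(* Let $\mathcal D\subset\mathbb C^n_*$ be a domain, let $Q_1,\dots,Q_n:\mathcal D\to\mathfrak M_k$ be holomorphic with $\sum_{p=1}^n Q_p(\boldsymbol t)\equiv 0$, and consider the deformation of a Fuchsian equation $$\frac{dY}{dx}=\Big(\sum_{1\le p\le n}\frac{Q_p(\boldsymbol t)}{x-t_p}\Big)Y .$$ Let $x_0\in\overline{\mathbb C}$ and $\boldsymbol t^0=(t_1^0,\dots,t_n^0)\in\mathcal D$ with $t_j^0\neq x_0$ for all $j$. Suppose that the deformation is isoprincipal in the wide sense with respect to $x_0$ at $\boldsymbol t^0$, so that for each $j$ (with a path $\alpha_j$ and numbers $\rho,\delta>0$ as in the definition) $$Y_{\alpha_j}(x,\boldsymbol t)=H_{\alpha_j}(x,\boldsymbol t)\,E_{\alpha_j}(x-t_j),\qquad x\in D_{t_j,\rho}\setminus\{t_j\},\ \boldsymbol t\in\mathsf D(\boldsymbol t^0,\delta).$$ Then for each $j=1,\dots,n$ there is a constant invertible matrix $M_{\alpha_j}$ (not depending on $\zeta$) such that $$E_{\alpha_j}(\zeta e^{2\pi i})=E_{\alpha_j}(\zeta)M_{\alpha_j}$$ for all $\zeta\neq0$ (i.e. for all $\zeta$ on the Riemann surface of the logarithm), and the monodromy matrix along the loop $\gamma_{\alpha_j}$ generated by $\alpha_j$ satisfies $$M_{\gamma_{\alpha_j}}(\boldsymbol t)=M_{\alpha_j},\qquad \boldsymbol t\in\mathsf D(\boldsymbol t^0,\delta),\ j=1,\dots,n .$$ In particular, the deformation is isomonodromic with respect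 to $x_0$ at $\boldsymbol t^0$.
   Context: $\mathfrak M_k$ is the set of complex $k\times k$ matrices, $\overline{\mathbb C}=\mathbb C\cup\{\infty\}$, and $\mathbb C^n_*$ is the set of $\boldsymbol t=(t_1,\dots,t_n)\in\mathbb C^n$ with pairwise distinct coordinates. $D_{a,r}=\{z\in\mathbb C:|z-a|<r\}$ and $\mathsf D(\boldsymbol t^0,\delta)=\prod_{p=1}^nD_{t_p^0,\delta}$; here $\delta$ is always so small that $\mathsf D(\boldsymbol t^0,\delta)\subset\mathcal D$. $\mathrm{cov}(X;x)$ is the universal covering of $X$ with distinguished point $x$; its points are pairs (point, homotopy class of a path from $x$ to it). Normalized solution and monodromy. $Y(x,\boldsymbol t)$ is the (multivalued in $x$) solution of the equation with $Y(x_0,\boldsymbol t)=I$. For a loop $\gamma$ in $\overline{\mathbb C}\setminus\{t_1,\dots,t_n\}$ starting and ending at $x_0$, the monodromy matrix $M_\gamma(\boldsymbol t)$ is the value at the end of $\gamma$ of the analytic continuation of $Y(\cdot,\boldsymbol t)$ along $\gamma$. Coherent continuation. Put $\rho_j(\boldsymbol t^0)=\frac12\min_{p\ne j}|t_j^0-t_p^0|$. Let $0<\rho\le\rho_j(\boldsymbol t^0)$, $0<2\delta<\rho$, let $x_j$ satisfy $\delta<|x_j-t_j^0|<\rho-\delta$, and let $\alpha_j$ be a path from $x_0$ to $x_j$ with $|z-t_p^0|>\delta$ for all $z\in\alpha_j$ and all $p$. Neither $x_j$ nor $\alpha_j$ depends on $\boldsymbol t$. For $\boldsymbol t\in\mathsf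 D(\boldsymbol t^0,\delta)$, $Y_{\alpha_j}(\cdot,\boldsymbol t)$ is the function on $\mathrm{cov}(D_{t_j,\rho}\setminus\{t_j\};x_j)$ whose value at $(x,\mu)$ is obtained by continuing $Y(\cdot,\boldsymbol t)$ from $x_0$ first along $\alpha_j$ and then along $\mu$. A value $\vartheta_j^0=\arg(x_j-t_j^0)$ is fixed, and for $t_j\in D_{t_j^0,\delta}$ one takes $\arg(x_j-t_j)\in(\vartheta_j^0-\pi/2,\vartheta_j^0+\pi/2)$; continuing along $\mu$ determines $\log(x-t_j)$, hence the value of any function of $x-t_j$ defined on the Riemann surface of the logarithm. Loop generated by $\alpha_j$. $\gamma_{\alpha_j}$ is the loop that traverses $\alpha_j$, then the circle centered at $t_j^0$ of radius $|x_j-t_j^0|$ once counterclockwise from $x_j$ to $x_j$, then $\alpha_j$ backwards. Isoprincipal (wide sense) at $\boldsymbol t^0$ with respect to $x_0$: for every $j=1,\dots,n$, for some $\rho,\delta>0$, some point $x_j$ and some path $\alpha_j$ from $x_0$ to $x_j$ satisfying $0<\rho\le\rho_j(\boldsymbol t^0)$, $0<2\delta<\rho$, $\delta<|x_j-t_j^0|<\rho-\delta$, and $|z-t_p^0|>\delta$ for all $z\in\alpha_j$ and all $p$, $Y_{\alpha_j}(x,\boldsymbol t)=H_{\alpha_j}(x,\boldsymbol t)E_{\alpha_j}(x-t_j)$ for $x\in D_{t_j,\rho}\setminus\{t_j\}$ (as points of the covering) and $\boldsymbol t\in\mathsf D(\boldsymbol t^0,\delta)$, where $H_{\alpha_j}$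 and $H_{\alpha_j}^{-1}$ are (single-valued) holomorphic in $(x,\boldsymbol t)$ for $x\in D_{t_j,\rho}$, $\boldsymbol t\in\mathsf D(\boldsymbol t^0,\delta)$, and $E_{\alpha_j}(\zeta)$ is a matrix function holomorphic with invertible values on the Riemann surface of the logarithm (the universal covering of $\mathbb C\setminus\{0\}$), not depending on $\boldsymbol t$ and $x$ (other than via $\zeta=x-t_j$). The same $\rho,\delta$ may be used for all $j$. Isomonodromic at $\boldsymbol t^0$ with respect to $x_0$: for every loop $\gamma\subset\overline{\mathbb C}\setminus\{t_1^0,\dots,t_n^0\}$ based at $x_0$ there is $\delta>0$ (depending on $\boldsymbol t^0,\gamma$, small enough that the $t_j$ stay off $\gamma$) with $M_\gamma(\boldsymbol t)=M_\gamma(\boldsymbol t^0)$ for all $\boldsymbol t\in\mathsf D(\boldsymbol t^0,\delta)$.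
   Formalization: The final claim (isomonodromic at t^0) is proved only if the loops generated by α_1,…,α_n generate the fundamental group of the sphere punctured at t_1^0,…,t_n^0; for arbitrary paths α_j it is false (2×2 triangular counterexample with n=3). *)

theory Defs
  imports "HOL-Analysis.Analysis"
begin

section \<open>The Riemann sphere\<close>

text \<open>The sphere as the one-point compactification of the complex plane. It is a type of its own
  (rather than the abstract topology \<open>Alexandroff_compactification\<close> on options) so that the
  library's paths, joins and homotopies apply to it.\<close>

datatype riemann_sphere = Fin complex | Infty

instantiation riemann_sphere :: topological_space
begin

definition open_riemann_sphere :: "riemann_sphere set \<Rightarrow> bool" where
  "open U \<longleftrightarrow> open (Fin -` U) \<and> (Infty \<in> U \<longrightarrow> compact (- (Fin -` U)))"

instance
proof
  show "open (UNIV :: riemann_sphere set)"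
    by (simp add: open_riemann_sphere_def)
next
  fix S T :: "riemann_sphere set"
  assume "open S" "open T"
  then show "open (S \<inter> T)"
    by (auto simp: open_riemann_sphere_def compact_Un)
next
  fix K :: "riemann_sphere set set"
  assume K: "\<forall>S\<in>K. open S"
  have op: "open (Fin -` \<Union>K)"
    using K by (auto simp: open_riemann_sphere_def vimage_Union)
  have "compact (- (Fin -` \<Union>K))" if inf: "Infty \<in> \<Union>K"
  proof -
    from inf obtain S where S: "S \<in> K" "Infty \<in> S"
      by blast
    then have "compact (- (Fin -` S))"
      using K by (simp add: open_riemann_sphere_def)
    moreover have "closed (- (Fin -` \<Union>K))"
      using op by (simp add: closed_def)
    ultimately have "compact (- (Fin -` S) \<inter> - (Fin -` \<Union>K))"
      by (rule compact_Int_closed)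
    moreover have "- (Fin -` S) \<inter> - (Fin -` \<Union>K) = - (Fin -` \<Union>K)"
      using S by auto
    ultimately show ?thesis
      by simp
  qed
  with op show "open (\<Union>K)"
    by (simp add: open_riemann_sphere_def)
qed

end

definition chart_at_Infty :: "complex \<Rightarrow> riemann_sphere" where
  "chart_at_Infty w = (if w = 0 then Infty else Fin (1 / w))"

section \<open>Holomorphic matrix functions\<close>

type_synonym 'k cmatrix = "complex ^ 'k ^ 'k"

definition sphere_analytic_at ::
  "(riemann_sphere \<Rightarrow> 'k::finite cmatrix) \<Rightarrow> riemann_sphere \<Rightarrow> bool" where
  "sphere_analytic_at F z \<longleftrightarrow>
     (case z of
        Fin a \<Rightarrow> \<forall>i k. (\<lambda>x. F (Fin x) $ i $ k) analytic_on {a}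
      | Infty \<Rightarrow> \<forall>i k. (\<lambda>w. F (chart_at_Infty w) $ i $ k) analytic_on {0})"

text \<open>Holomorphy in several variables on an open set, as complex Frechet differentiability: the
  real derivative commutes with the multiplication \<open>sc\<close> by complex scalars. The scaling is a
  parameter because there is no type class of complex vector spaces.\<close>

definition holomorphic_several ::
  "(complex \<Rightarrow> 'v \<Rightarrow> 'v) \<Rightarrow> ('v::real_normed_vector \<Rightarrow> complex) \<Rightarrow> 'v set \<Rightarrow> bool" where
  "holomorphic_several sc f S \<longleftrightarrow>
     (\<forall>p\<in>S. \<exists>L. (f has_derivative L) (at p) \<and> (\<forall>c v. L (sc c v) = c * L v))"

definition matrix_holomorphic_on ::
  "(complex ^ 'n \<Rightarrow> 'k::finite cmatrix) \<Rightarrow> (complex ^ 'n::finite) set \<Rightarrow> bool" where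
  "matrix_holomorphic_on F S \<longleftrightarrow>
     (\<forall>i k. holomorphic_several (\<lambda>c t. c *s t) (\<lambda>t. F t $ i $ k) S)"

definition matrix_jointly_holomorphic_on ::
  "(complex \<Rightarrow> complex ^ 'n \<Rightarrow> 'k::finite cmatrix) \<Rightarrow> (complex \<times> (complex ^ 'n::finite)) set \<Rightarrow> bool" where
  "matrix_jointly_holomorphic_on F S \<longleftrightarrow>
     (\<forall>i k. holomorphic_several (\<lambda>c (x, t). (c * x, c *s t)) (\<lambda>(x, t). F x t $ i $ k) S)"

section \<open>The deformation, its normalized solution and monodromy\<close>

definition fuchsian_deformation ::
  "(complex ^ 'n::finite) set \<Rightarrow> ('n \<Rightarrow> complex ^ 'n \<Rightarrow> 'k::finite cmatrix) \<Rightarrow> bool" where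
  "fuchsian_deformation D Q \<longleftrightarrow>
     open D \<and> connected D \<and>
     (\<forall>t\<in>D. \<forall>p q. p \<noteq> q \<longrightarrow> t $ p \<noteq> t $ q) \<and>
     (\<forall>p. matrix_holomorphic_on (Q p) D) \<and>
     (\<forall>t\<in>D. (\<Sum>p\<in>UNIV. Q p t) = 0)"

definition fuchsian_coeff ::
  "('n::finite \<Rightarrow> complex ^ 'n \<Rightarrow> 'k::finite cmatrix) \<Rightarrow> complex ^ 'n \<Rightarrow> complex \<Rightarrow> 'k cmatrix" where
  "fuchsian_coeff Q t x = (\<chi> i k. \<Sum>p\<in>UNIV. Q p t $ i $ k / (x - t $ p))"

text \<open>For \<open>x0 = Infty\<close> the equation is imposed at the finite points near infinity; together with
  analyticity and the value at infinity this determines the germ.\<close>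

definition normalized_local_solution ::
  "('n::finite \<Rightarrow> complex ^ 'n \<Rightarrow> 'k::finite cmatrix) \<Rightarrow> riemann_sphere \<Rightarrow> complex ^ 'n \<Rightarrow>
   (riemann_sphere \<Rightarrow> 'k cmatrix) \<Rightarrow> bool" where
  "normalized_local_solution Q x0 t Y \<longleftrightarrow>
     sphere_analytic_at Y x0 \<and> Y x0 = mat 1 \<and>
     (\<forall>\<^sub>F z in nhds x0. \<forall>x. z = Fin x \<longrightarrow>
        (\<forall>i k. ((\<lambda>u. Y (Fin u) $ i $ k) has_field_derivative
                 (fuchsian_coeff Q t x ** Y (Fin x)) $ i $ k) (at x)))"

text \<open>\<open>\<Phi> s\<close> represents the germ at \<open>\<gamma> s\<close>; neighbouring germs have to agree.\<close>

definition analytic_continuation_along ::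
  "(real \<Rightarrow> riemann_sphere) \<Rightarrow> (real \<Rightarrow> riemann_sphere \<Rightarrow> 'k::finite cmatrix) \<Rightarrow> bool" where
  "analytic_continuation_along \<gamma> \<Phi> \<longleftrightarrow>
     (\<forall>s\<in>{0..1}. sphere_analytic_at (\<Phi> s) (\<gamma> s) \<and>
        (\<forall>\<^sub>F s' in at s within {0..1}. \<forall>\<^sub>F z in nhds (\<gamma> s'). \<Phi> s' z = \<Phi> s z))"

text \<open>The value at the end of \<open>\<gamma>\<close> of the continuation along \<open>\<gamma>\<close> of the solution \<open>Y(\<cdot>, t)\<close> with
  \<open>Y(x0, t) = I\<close>; meaningful for paths that start at \<open>x0\<close> and avoid all \<open>t $ p\<close>, for which the
  continuation exists and its germ at the end is unique.\<close>

definition continued_solution ::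
  "('n::finite \<Rightarrow> complex ^ 'n \<Rightarrow> 'k::finite cmatrix) \<Rightarrow> riemann_sphere \<Rightarrow> complex ^ 'n \<Rightarrow>
   (real \<Rightarrow> riemann_sphere) \<Rightarrow> 'k cmatrix" where
  "continued_solution Q x0 t \<gamma> =
     (THE M. \<exists>\<Phi>. analytic_continuation_along \<gamma> \<Phi> \<and> normalized_local_solution Q x0 t (\<Phi> 0) \<and>
                 M = \<Phi> 1 (pathfinish \<gamma>))"

definition loop_in :: "'a::topological_space set \<Rightarrow> 'a \<Rightarrow> (real \<Rightarrow> 'a) \<Rightarrow> bool" where
  "loop_in S x \<gamma> \<longleftrightarrow>
     path \<gamma> \<and> path_image \<gamma> \<subseteq> S \<and> pathstart \<gamma> = x \<and> pathfinish \<gamma> = x"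

text \<open>The monodromy matrix along a loop at \<open>x0\<close>.\<close>

abbreviation monodromy ::
  "('n::finite \<Rightarrow> complex ^ 'n \<Rightarrow> 'k::finite cmatrix) \<Rightarrow> riemann_sphere \<Rightarrow>
   (real \<Rightarrow> riemann_sphere) \<Rightarrow> complex ^ 'n \<Rightarrow> 'k cmatrix" where
  "monodromy Q x0 \<gamma> t \<equiv> continued_solution Q x0 t \<gamma>"

definition punctured_sphere :: "complex ^ 'n::finite \<Rightarrow> riemann_sphere set" where
  "punctured_sphere t = - range (\<lambda>p. Fin (t $ p))"

definition polydisc :: "complex ^ 'n::finite \<Rightarrow> real \<Rightarrow> (complex ^ 'n) set" where
  "polydisc t0 \<delta> = {t. \<forall>p. t $ p \<in> ball (t0 $ p) \<delta>}"

definition isomonodromic_at ::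
  "(complex ^ 'n::finite) set \<Rightarrow> ('n \<Rightarrow> complex ^ 'n \<Rightarrow> 'k::finite cmatrix) \<Rightarrow> riemann_sphere \<Rightarrow>
   complex ^ 'n \<Rightarrow> bool" where
  "isomonodromic_at D Q x0 t0 \<longleftrightarrow>
     (\<forall>\<gamma>. loop_in (punctured_sphere t0) x0 \<gamma> \<longrightarrow>
       (\<exists>\<delta>>0. polydisc t0 \<delta> \<subseteq> D \<and>
          (\<forall>t\<in>polydisc t0 \<delta>. path_image \<gamma> \<subseteq> punctured_sphere t \<and>
             monodromy Q x0 \<gamma> t = monodromy Q x0 \<gamma> t0)))"

section \<open>The isoprincipal property\<close>

text \<open>The conditions on \<open>\<rho>\<close>, \<open>\<delta>\<close>, \<open>x_j\<close> (here \<open>xj\<close>) and \<open>\<alpha>\<close>. For a single pole the bound on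
  \<open>\<rho>\<close> is void (minimum over the empty set).\<close>

definition admissible_path ::
  "(complex ^ 'n::finite) set \<Rightarrow> riemann_sphere \<Rightarrow> complex ^ 'n \<Rightarrow> 'n \<Rightarrow> real \<Rightarrow> real \<Rightarrow> complex \<Rightarrow>
   (real \<Rightarrow> riemann_sphere) \<Rightarrow> bool" where
  "admissible_path D x0 t0 j \<rho> \<delta> xj \<alpha> \<longleftrightarrow>
     0 < \<rho> \<and> (\<forall>p. p \<noteq> j \<longrightarrow> \<rho> \<le> cmod (t0 $ j - t0 $ p) / 2) \<and>
     0 < \<delta> \<and> 2 * \<delta> < \<rho> \<and> polydisc t0 \<delta> \<subseteq> D \<and>
     \<delta> < cmod (xj - t0 $ j) \<and> cmod (xj - t0 $ j) < \<rho> - \<delta> \<and>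
     path \<alpha> \<and> pathstart \<alpha> = x0 \<and> pathfinish \<alpha> = Fin xj \<and>
     (\<forall>z p. Fin z \<in> path_image \<alpha> \<longrightarrow> \<delta> < cmod (z - t0 $ p))"

text \<open>The Riemann surface of the logarithm is uniformized by \<open>w = log \<zeta>\<close>, that is, modelled by the
  covering \<open>exp\<close> of the punctured plane: a function \<open>E(\<zeta>)\<close> on it is given as a function \<open>E w\<close> on
  the complex plane, is holomorphic iff the latter is, and \<open>E(\<zeta> e\<^bsup>2\<pi>i\<^esup>)\<close> is
  \<open>E (w + 2\<pi>i)\<close>.

  A point of the covering of the punctured disc around \<open>t $ j\<close> is represented by a path \<open>\<mu>\<close> in that
  disc from \<open>xj\<close>. The continuous branch \<open>l\<close> of \<open>log (\<mu> - t $ j)\<close> starts with the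
  argument in \<open>(\<theta> - \<pi>/2, \<theta> + \<pi>/2)\<close> and \<open>l 1\<close> is the value of \<open>log (x - t $ j)\<close> at the
  point represented by \<open>\<mu>\<close>.\<close>

definition isoprincipal_representation ::
  "(complex ^ 'n::finite) set \<Rightarrow> ('n \<Rightarrow> complex ^ 'n \<Rightarrow> 'k::finite cmatrix) \<Rightarrow> riemann_sphere \<Rightarrow>
   complex ^ 'n \<Rightarrow> 'n \<Rightarrow> real \<Rightarrow> real \<Rightarrow> complex \<Rightarrow> real \<Rightarrow> (real \<Rightarrow> riemann_sphere) \<Rightarrow>
   (complex \<Rightarrow> complex ^ 'n \<Rightarrow> 'k cmatrix) \<Rightarrow> (complex \<Rightarrow> 'k cmatrix) \<Rightarrow> bool" where
  "isoprincipal_representation D Q x0 t0 j \<rho> \<delta> xj \<theta> \<alpha> H E \<longleftrightarrow>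
     admissible_path D x0 t0 j \<rho> \<delta> xj \<alpha> \<and>
     is_Arg (xj - t0 $ j) \<theta> \<and>
     (\<forall>t\<in>polydisc t0 \<delta>. \<forall>x\<in>ball (t $ j) \<rho>. invertible (H x t)) \<and>
     matrix_jointly_holomorphic_on H
       {(x, t). t \<in> polydisc t0 \<delta> \<and> x \<in> ball (t $ j) \<rho>} \<and>
     matrix_jointly_holomorphic_on (\<lambda>x t. matrix_inv (H x t))
       {(x, t). t \<in> polydisc t0 \<delta> \<and> x \<in> ball (t $ j) \<rho>} \<and>
     (\<forall>i k. (\<lambda>w. E w $ i $ k) holomorphic_on UNIV) \<and>
     (\<forall>w. invertible (E w)) \<and>
     (\<forall>t\<in>polydisc t0 \<delta>. \<forall>\<mu> l.
        path \<mu> \<and> path_image \<mu> \<subseteq> ball (t $ j) \<rho> - {t $ j} \<and> pathstart \<mu> = xj \<and>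
        continuous_on {0..1} l \<and> (\<forall>s\<in>{0..1}. exp (l s) = \<mu> s - t $ j) \<and>
        \<theta> - pi / 2 < Im (l 0) \<and> Im (l 0) < \<theta> + pi / 2 \<longrightarrow>
        continued_solution Q x0 t (\<alpha> +++ (Fin \<circ> \<mu>)) = H (pathfinish \<mu>) t ** E (l 1))"

text \<open>The deformation is isoprincipal in the wide sense at \<open>t0\<close> with respect to \<open>x0\<close> if there are
  data, indexed by the poles, as follows.\<close>

definition isoprincipal_wide_with ::
  "(complex ^ 'n::finite) set \<Rightarrow> ('n \<Rightarrow> complex ^ 'n \<Rightarrow> 'k::finite cmatrix) \<Rightarrow> riemann_sphere \<Rightarrow>
   complex ^ 'n \<Rightarrow> ('n \<Rightarrow> real) \<Rightarrow> ('n \<Rightarrow> real) \<Rightarrow> ('n \<Rightarrow> complex) \<Rightarrow> ('n \<Rightarrow> real) \<Rightarrow>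
   ('n \<Rightarrow> real \<Rightarrow> riemann_sphere) \<Rightarrow> ('n \<Rightarrow> complex \<Rightarrow> complex ^ 'n \<Rightarrow> 'k cmatrix) \<Rightarrow>
   ('n \<Rightarrow> complex \<Rightarrow> 'k cmatrix) \<Rightarrow> bool" where
  "isoprincipal_wide_with D Q x0 t0 \<rho> \<delta> xx \<theta> \<alpha> H E \<longleftrightarrow>
     (\<forall>j. isoprincipal_representation D Q x0 t0 j (\<rho> j) (\<delta> j) (xx j) (\<theta> j) (\<alpha> j) (H j) (E j))"

definition circle_from :: "complex \<Rightarrow> complex \<Rightarrow> real \<Rightarrow> complex" where
  "circle_from a x s = a + (x - a) * exp (2 * of_real pi * \<i> * of_real s)"

definition generated_loop ::
  "complex \<Rightarrow> complex \<Rightarrow> (real \<Rightarrow> riemann_sphere) \<Rightarrow> real \<Rightarrow> riemann_sphere" where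
  "generated_loop a x \<alpha> = \<alpha> +++ (Fin \<circ> circle_from a x) +++ reversepath \<alpha>"

section \<open>Generators of the fundamental group\<close>

text \<open>The isoprincipal property concerns one arbitrary path per pole; the loops generated by such paths
  need not generate the fundamental group of the punctured sphere, and without that property constancy
  of the monodromy along them does not imply isomonodromy.\<close>

primrec loop_product :: "'a::topological_space \<Rightarrow> (real \<Rightarrow> 'a) list \<Rightarrow> real \<Rightarrow> 'a" where
  "loop_product x [] = (\<lambda>_. x)"
| "loop_product x (g # gs) = g +++ loop_product x gs"

definition generates_fundamental_group ::
  "'a::topological_space set \<Rightarrow> 'a \<Rightarrow> (real \<Rightarrow> 'a) set \<Rightarrow> bool" where
  "generates_fundamental_group S x G \<longleftrightarrow>
     (\<forall>g\<in>G. loop_in S x g) \<and>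
     (\<forall>\<gamma>. loop_in S x \<gamma> \<longrightarrow>
        (\<exists>gs. set gs \<subseteq> G \<union> reversepath ` G \<and> homotopic_paths S \<gamma> (loop_product x gs)))"

end

theory Submission
  imports Defs "HOL-Complex_Analysis.Complex_Analysis"
begin

text \<open>For fixed \<open>t\<close> the solutions of the equation form a local system on the punctured sphere: since
  the residues add up to zero, every point, infinity included, has a neighbourhood with an invertible
  fundamental solution. Analytic continuation of the normalized solution is therefore parallel
  transport, which is invariant under homotopies and multiplicative on loops.

  In the coordinate \<open>w = log (x - t0 $ j)\<close> the product \<open>H E\<close> is parallel on a half plane, along which
  the equation is invariant under \<open>w \<mapsto> w + 2\<pi>i\<close>. Hence \<open>E(w + 2\<pi>i) = E(w) M\<close> with a constant \<open>M\<close>,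
  first on the half plane and then everywhere by the identity theorem. For any \<open>t\<close>, continuing along
  the circle adds \<open>2\<pi>i\<close> to \<open>log (x - t $ j)\<close> and so multiplies the solution by this same \<open>M\<close>, which
  the way back along \<open>\<alpha>\<close> carries to the base point. A homotopy between a loop and a product of
  generators has a compact image, so it persists for all \<open>t\<close> close to \<open>t0\<close>.\<close>

text \<open>Paths are merely continuous, so the equation cannot be integrated along them, and
  \<open>analytic_continuation_along\<close> asks its germs only to be analytic, not to satisfy the
  equation. Both obstacles are met by connectedness: equality of two sections, invertibility of a
  section, and being a solution are each locally constant along a path. Constants act on solutions
  from the right, because the coefficient multiplies from the left; this is why \<open>M\<close>
  stands on the right of \<open>E\<close> and why monodromy reverses the order of loops. The half
  plane in question is \<open>Re w < ln \<rho>\<close>, the preimage under \<open>exp\<close> of the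
  punctured disc on which \<open>H\<close> is available. In comparing the values before and after
  the circle, \<open>t\<close> enters only through \<open>H\<close>, which is single-valued and
  keeps its value, and through the initial branch of the logarithm, which is immaterial because the
  relation for \<open>E\<close> holds at every \<open>w\<close>.\<close>

lemma invertible_mult_left_cancel:
  fixes A :: "'a::comm_ring_1 ^ 'k::finite ^ 'k"
  assumes "invertible A"
  shows "A ** B = A ** C \<longleftrightarrow> B = C"
proof
  obtain A' where A': "A' ** A = mat 1"
    using assms unfolding invertible_def by blast
  assume "A ** B = A ** C"
  then have "A' ** A ** B = A' ** A ** C"
    by (simp add: matrix_mul_assoc [symmetric])
  then show "B = C"
    by (simp add: A')
qed simp

lemma invertible_mult_left_iff:
  fixes A B :: "'a::field ^ 'k::finite ^ 'k"
  assumes "invertible A"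
  shows "invertible (A ** B) \<longleftrightarrow> invertible B"
  using assms by (simp add: invertible_det_nz det_mul)

text \<open>With \<open>nhds p\<close> and the premise \<open>q \<in> A\<close>, instead of
  \<open>at p within A\<close>, the point \<open>p\<close> itself is included, so an eventual
  identity can be evaluated at \<open>p\<close>.\<close>

lemma eventually_nhds_continuous_on:
  assumes "continuous_on A h" "p \<in> A" "eventually P (nhds (h p))"
  shows "\<forall>\<^sub>F q in nhds p. q \<in> A \<longrightarrow> P (h q)"
proof -
  have "(h \<longlongrightarrow> h p) (at p within A)"
    using assms by (simp add: continuous_on_def)
  then have "\<forall>\<^sub>F q in at p within A. P (h q)"
    using assms(3) by (rule filterlim_iff [THEN iffD1, rule_format])
  moreover have "P (h p)"
    using assms(3) by (rule eventually_nhds_x_imp_x)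
  ultimately show ?thesis
    by (auto simp: eventually_at_filter elim: eventually_mono)
qed

section \<open>Local systems and parallel transport\<close>

text \<open>Frames play the part of local fundamental solutions. \<open>frame_compatible\<close>
  asks for a constant transition matrix only near a point: an intersection of two frame domains may
  be disconnected, with different constants on its components.\<close>

locale local_system =
  fixes X :: "'x::topological_space set"
    and frame :: "'x set \<Rightarrow> ('x \<Rightarrow> complex ^ 'k::finite ^ 'k) \<Rightarrow> bool"
  assumes frame_open: "frame U \<Phi> \<Longrightarrow> open U"
    and frame_invertible: "frame U \<Phi> \<Longrightarrow> z \<in> U \<Longrightarrow> invertible (\<Phi> z)"
    and frame_exists: "z \<in> X \<Longrightarrow> \<exists>U \<Phi>. frame U \<Phi> \<and> z \<in> U"
    and frame_compatible: "frame U \<Phi> \<Longrightarrow> frame V \<Psi> \<Longrightarrow> z \<in> U \<Longrightarrow> z \<in> V \<Longrightarrow>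
      \<exists>C. \<forall>\<^sub>F y in nhds z. \<Psi> y = \<Phi> y ** C"
begin

text \<open>A parallel section of the pullback of the local system along \<open>h\<close>. The
  parameter set \<open>A\<close> is general because intervals (paths), squares (homotopies) and a
  half plane (logarithmic coordinate) all occur.\<close>

definition parallel_on ::
  "'p::topological_space set \<Rightarrow> ('p \<Rightarrow> 'x) \<Rightarrow> ('p \<Rightarrow> complex ^ 'k ^ 'k) \<Rightarrow> bool" where
  "parallel_on A h g \<longleftrightarrow>
     (\<forall>p\<in>A. \<exists>U \<Phi> C. frame U \<Phi> \<and> h p \<in> U \<and>
        (\<forall>\<^sub>F q in nhds p. q \<in> A \<longrightarrow> g q = \<Phi> (h q) ** C))"

lemma parallel_onE:
  assumes "parallel_on A h g" "p \<in> A"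
  obtains U \<Phi> C where "frame U \<Phi>" "h p \<in> U" "\<forall>\<^sub>F q in nhds p. q \<in> A \<longrightarrow> g q = \<Phi> (h q) ** C"
  using assms unfolding parallel_on_def by blast

text \<open>The transition matrix absorbs a change of frame, so two sections over the same map can
  be compared in one frame.\<close>

lemma parallel_on_frame:
  assumes g: "parallel_on A h g" and h: "continuous_on A h" and p: "p \<in> A"
    and V: "frame V \<Psi>" "h p \<in> V"
  obtains C where "\<forall>\<^sub>F q in nhds p. q \<in> A \<longrightarrow> g q = \<Psi> (h q) ** C"
proof -
  obtain U \<Phi> C where U: "frame U \<Phi>" "h p \<in> U"
    and C: "\<forall>\<^sub>F q in nhds p. q \<in> A \<longrightarrow> g q = \<Phi> (h q) ** C"
    using g p by (rule parallel_onE)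
  obtain D where "\<forall>\<^sub>F y in nhds (h p). \<Phi> y = \<Psi> y ** D"
    using frame_compatible [OF V(1) U(1) V(2) U(2)] by blast
  then have "\<forall>\<^sub>F q in nhds p. q \<in> A \<longrightarrow> \<Phi> (h q) = \<Psi> (h q) ** D"
    by (rule eventually_nhds_continuous_on [OF h p])
  with C have "\<forall>\<^sub>F q in nhds p. q \<in> A \<longrightarrow> g q = \<Psi> (h q) ** (D ** C)"
    by eventually_elim (simp add: matrix_mul_assoc)
  then show thesis by (rule that)
qed

lemma frame_near:
  assumes h: "continuous_on A h" and p: "p \<in> A" and V: "frame V \<Psi>" "h p \<in> V"
  shows "\<forall>\<^sub>F q in nhds p. q \<in> A \<longrightarrow> invertible (\<Psi> (h q))"
proof (rule eventually_nhds_continuous_on [OF h p])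
  show "\<forall>\<^sub>F y in nhds (h p). invertible (\<Psi> y)"
    using V frame_open [OF V(1)] frame_invertible [OF V(1)]
    by (auto simp: eventually_nhds)
qed

text \<open>In one frame \<open>\<Phi>\<close> the sections are \<open>\<Phi>\<close> times
  constants \<open>C\<close> and \<open>D\<close>. As \<open>\<Phi>\<close> is invertible, they
  agree at a nearby point exactly if \<open>C = D\<close>, which does not involve the point; so
  agreement is locally constant on the connected set \<open>A\<close>.\<close>

lemma parallel_on_unique:
  assumes g1: "parallel_on A h g1" and g2: "parallel_on A h g2" and h: "continuous_on A h"
    and A: "connected A" and p: "p \<in> A" and q: "q \<in> A" and eq: "g1 p = g2 p"
  shows "g1 q = g2 q"
proof -
  have "(g1 p = g2 p) = (g1 q = g2 q)"
  proof (rule connected_local_const [OF A p q], intro ballI)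
    fix r assume r: "r \<in> A"
    obtain U \<Phi> C where U: "frame U \<Phi>" "h r \<in> U"
      and C: "\<forall>\<^sub>F q in nhds r. q \<in> A \<longrightarrow> g1 q = \<Phi> (h q) ** C"
      using g1 r by (rule parallel_onE)
    obtain D where D: "\<forall>\<^sub>F q in nhds r. q \<in> A \<longrightarrow> g2 q = \<Phi> (h q) ** D"
      using g2 h r U by (rule parallel_on_frame)
    have "\<forall>\<^sub>F q in nhds r. q \<in> A \<longrightarrow> (g1 q = g2 q \<longleftrightarrow> C = D)"
      using C D frame_near [OF h r U]
      by eventually_elim (auto simp: invertible_mult_left_cancel)
    moreover from this have "g1 r = g2 r \<longleftrightarrow> C = D"
      using eventually_nhds_x_imp_x r by blast
    ultimately show "\<forall>\<^sub>F q in at r within A. (g1 r = g2 r) = (g1 q = g2 q)"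
      by (auto simp: eventually_at_filter elim: eventually_mono)
  qed
  with eq show ?thesis by simp
qed

text \<open>Near each point, invertibility of the section is invertibility of its constant
  \<open>C\<close>, hence again locally constant.\<close>

lemma parallel_on_invertible:
  assumes g: "parallel_on A h g" and h: "continuous_on A h"
    and A: "connected A" and p: "p \<in> A" and q: "q \<in> A" and inv: "invertible (g p)"
  shows "invertible (g q)"
proof -
  have "invertible (g p) = invertible (g q)"
  proof (rule connected_local_const [OF A p q], intro ballI)
    fix r assume r: "r \<in> A"
    obtain U \<Phi> C where U: "frame U \<Phi>" "h r \<in> U"
      and C: "\<forall>\<^sub>F q in nhds r. q \<in> A \<longrightarrow> g q = \<Phi> (h q) ** C"
      using g r by (rule parallel_onE)
    have "\<forall>\<^sub>F q in nhds r. q \<in> A \<longrightarrow> (invertible (g q) \<longleftrightarrow> invertible C)"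
      using C frame_near [OF h r U]
      by eventually_elim (auto simp: invertible_mult_left_iff)
    moreover from this have "invertible (g r) \<longleftrightarrow> invertible C"
      using eventually_nhds_x_imp_x r by blast
    ultimately show "\<forall>\<^sub>F q in at r within A. invertible (g r) = invertible (g q)"
      by (auto simp: eventually_at_filter elim: eventually_mono)
  qed
  with inv show ?thesis by simp
qed

lemma parallel_on_mult:
  assumes "parallel_on A h g"
  shows "parallel_on A h (\<lambda>p. g p ** M)"
  unfolding parallel_on_def
proof
  fix p assume "p \<in> A"
  with assms obtain U \<Phi> C where U: "frame U \<Phi>" "h p \<in> U"
      and "\<forall>\<^sub>F q in nhds p. q \<in> A \<longrightarrow> g q = \<Phi> (h q) ** C"
    by (rule parallel_onE)
  then have "\<forall>\<^sub>F q in nhds p. q \<in> A \<longrightarrow> g q ** M = \<Phi> (h q) ** (C ** M)"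
    by (auto simp: matrix_mul_assoc elim: eventually_mono)
  with U show "\<exists>U \<Phi> C. frame U \<Phi> \<and> h p \<in> U \<and>
      (\<forall>\<^sub>F q in nhds p. q \<in> A \<longrightarrow> g q ** M = \<Phi> (h q) ** C)"
    by blast
qed

lemma parallel_on_compose:
  assumes g: "parallel_on B h g" and f: "continuous_on A f" "f ` A \<subseteq> B"
  shows "parallel_on A (h \<circ> f) (g \<circ> f)"
  unfolding parallel_on_def
proof
  fix p assume p: "p \<in> A"
  with f have "f p \<in> B" by blast
  with g obtain U \<Phi> C where U: "frame U \<Phi>" "h (f p) \<in> U"
      and "\<forall>\<^sub>F q in nhds (f p). q \<in> B \<longrightarrow> g q = \<Phi> (h q) ** C"
    by (rule parallel_onE)
  from eventually_nhds_continuous_on [OF f(1) p this(3)]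
  have "\<forall>\<^sub>F q in nhds p. q \<in> A \<longrightarrow> (g \<circ> f) q = \<Phi> ((h \<circ> f) q) ** C"
    by (rule eventually_mono) (use f(2) in auto)
  with U show "\<exists>U \<Phi> C. frame U \<Phi> \<and> (h \<circ> f) p \<in> U \<and>
      (\<forall>\<^sub>F q in nhds p. q \<in> A \<longrightarrow> (g \<circ> f) q = \<Phi> ((h \<circ> f) q) ** C)"
    by auto
qed

lemma parallel_on_cong:
  assumes "parallel_on A h g" "\<And>p. p \<in> A \<Longrightarrow> h p = h' p" "\<And>p. p \<in> A \<Longrightarrow> g p = g' p"
  shows "parallel_on A h' g'"
  using assms unfolding parallel_on_def by (simp cong: imp_cong)

lemma parallel_on_subset:
  assumes "parallel_on B h g" "A \<subseteq> B"
  shows "parallel_on A h g"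
proof -
  have "parallel_on A (h \<circ> (\<lambda>x. x)) (g \<circ> (\<lambda>x. x))"
    using assms by (intro parallel_on_compose) auto
  then show ?thesis by (simp add: comp_def)
qed

lemma parallel_on_in_frame:
  assumes "frame U \<Phi>" "h ` A \<subseteq> U"
  shows "parallel_on A h (\<lambda>p. \<Phi> (h p) ** C)"
  using assms unfolding parallel_on_def by (auto intro!: exI [of _ U] exI [of _ \<Phi>] exI [of _ C])

lemma parallel_on_const:
  assumes "z \<in> X"
  shows "parallel_on A (\<lambda>_. z) (\<lambda>_. M)"
proof -
  obtain U \<Phi> where U: "frame U \<Phi>" "z \<in> U"
    using frame_exists [OF assms] by blast
  obtain B where "\<Phi> z ** B = mat 1"
    using frame_invertible [OF U] unfolding invertible_def by blast
  then have "\<Phi> z ** (B ** M) = M"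
    by (simp add: matrix_mul_assoc)
  then show ?thesis
    using parallel_on_in_frame [of U \<Phi> "\<lambda>_. z" A "B ** M"] U by auto
qed

text \<open>Only points of \<open>A \<inter> B\<close> are delicate: equality at that single point
  forces equal constants in a common frame. Closedness removes the other set from a neighbourhood of
  a point outside it.\<close>

lemma parallel_on_glue:
  assumes g1: "parallel_on A g f1" and g2: "parallel_on B g f2"
    and cl: "closed A" "closed B" and g: "continuous_on (A \<union> B) g"
    and eq: "\<And>p. p \<in> A \<Longrightarrow> p \<in> B \<Longrightarrow> f1 p = f2 p"
  shows "parallel_on (A \<union> B) g (\<lambda>p. if p \<in> A then f1 p else f2 p)"
  unfolding parallel_on_def
proof
  have gA: "continuous_on A g" and gB: "continuous_on B g"
    using g by (auto intro: continuous_on_subset)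
  have off: "\<forall>\<^sub>F q in nhds p. q \<notin> S" if "closed S" "p \<notin> S" for p S
    using that eventually_nhds_in_open [of "- S" p] by (simp add: open_Compl)
  fix p assume p: "p \<in> A \<union> B"
  consider "p \<in> A" "p \<in> B" | "p \<in> A" "p \<notin> B" | "p \<notin> A" "p \<in> B"
    using p by blast
  then show "\<exists>U \<Phi> C. frame U \<Phi> \<and> g p \<in> U \<and>
      (\<forall>\<^sub>F q in nhds p. q \<in> A \<union> B \<longrightarrow> (if q \<in> A then f1 q else f2 q) = \<Phi> (g q) ** C)"
  proof cases
    case 1
    obtain U \<Phi> C where U: "frame U \<Phi>" "g p \<in> U"
      and C: "\<forall>\<^sub>F q in nhds p. q \<in> A \<longrightarrow> f1 q = \<Phi> (g q) ** C"
      using g1 1(1) by (rule parallel_onE)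
    obtain D where D: "\<forall>\<^sub>F q in nhds p. q \<in> B \<longrightarrow> f2 q = \<Phi> (g q) ** D"
      using g2 gB 1(2) U by (rule parallel_on_frame)
    have "\<Phi> (g p) ** C = \<Phi> (g p) ** D"
      using eventually_nhds_x_imp_x [OF C] eventually_nhds_x_imp_x [OF D] 1 eq by simp
    then have "C = D"
      using frame_invertible [OF U] by (simp add: invertible_mult_left_cancel)
    then have "\<forall>\<^sub>F q in nhds p. q \<in> A \<union> B \<longrightarrow> (if q \<in> A then f1 q else f2 q) = \<Phi> (g q) ** C"
      using C D unfolding \<open>C = D\<close> by eventually_elim auto
    with U show ?thesis by blast
  next
    case 2
    obtain U \<Phi> C where U: "frame U \<Phi>" "g p \<in> U"
      and C: "\<forall>\<^sub>F q in nhds p. q \<in> A \<longrightarrow> f1 q = \<Phi> (g q) ** C"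
      using g1 2(1) by (rule parallel_onE)
    have "\<forall>\<^sub>F q in nhds p. q \<in> A \<union> B \<longrightarrow> (if q \<in> A then f1 q else f2 q) = \<Phi> (g q) ** C"
      using C off [OF cl(2) 2(2)] by eventually_elim auto
    with U show ?thesis by blast
  next
    case 3
    obtain U \<Phi> C where U: "frame U \<Phi>" "g p \<in> U"
      and C: "\<forall>\<^sub>F q in nhds p. q \<in> B \<longrightarrow> f2 q = \<Phi> (g q) ** C"
      using g2 3(2) by (rule parallel_onE)
    have "\<forall>\<^sub>F q in nhds p. q \<in> A \<union> B \<longrightarrow> (if q \<in> A then f1 q else f2 q) = \<Phi> (g q) ** C"
      using C off [OF cl(1) 3(1)] by eventually_elim auto
    with U show ?thesis by blast
  qed
qed

lemma parallel_on_join: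
  assumes g1: "parallel_on {0..1} \<gamma>1 g1" and g2: "parallel_on {0..1} \<gamma>2 g2"
    and path: "path \<gamma>1" "path \<gamma>2" "pathfinish \<gamma>1 = pathstart \<gamma>2" and eq: "g1 1 = g2 0"
  shows "parallel_on {0..1} (\<gamma>1 +++ \<gamma>2) (g1 +++ g2)"
proof -
  have 1: "parallel_on {0..1/2} (\<gamma>1 +++ \<gamma>2) (\<lambda>s. g1 (2 * s))"
  proof (rule parallel_on_cong)
    show "parallel_on {0..1/2} (\<gamma>1 \<circ> (\<lambda>s. 2 * s)) (g1 \<circ> (\<lambda>s. 2 * s))"
      by (rule parallel_on_compose [OF g1]) (auto intro!: continuous_intros)
  qed (auto simp: joinpaths_def)
  have 2: "parallel_on {1/2..1} (\<gamma>1 +++ \<gamma>2) (\<lambda>s. g2 (2 * s - 1))"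
  proof (rule parallel_on_cong)
    show "parallel_on {1/2..1} (\<gamma>2 \<circ> (\<lambda>s. 2 * s - 1)) (g2 \<circ> (\<lambda>s. 2 * s - 1))"
      by (rule parallel_on_compose [OF g2]) (auto intro!: continuous_intros)
    fix s :: real assume s: "s \<in> {1/2..1}"
    show "(\<gamma>2 \<circ> (\<lambda>s. 2 * s - 1)) s = (\<gamma>1 +++ \<gamma>2) s"
    \<comment> \<open>\<open>joinpaths\<close> uses its first branch at 1/2, so there the claim
      rests on the matching endpoints.\<close>
    proof (cases "s = 1/2")
      case True
      show ?thesis
        unfolding True using path(3) by (simp add: joinpaths_def pathfinish_def pathstart_def)
    qed (use s in \<open>auto simp: joinpaths_def\<close>)
  qed auto
  have U: "{0..1/2} \<union> {1/2..1} = {0..1::real}"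
    by auto
  have "continuous_on {0..1} (\<gamma>1 +++ \<gamma>2)"
    using path path_join_imp path_def by blast
  then have "parallel_on ({0..1/2} \<union> {1/2..1}) (\<gamma>1 +++ \<gamma>2)
      (\<lambda>s. if s \<in> {0..1/2} then g1 (2 * s) else g2 (2 * s - 1))"
  proof (intro parallel_on_glue [OF 1 2])
    fix s :: real assume "s \<in> {0..1/2}" "s \<in> {1/2..1}"
    then have "s = 1/2" by simp
    show "g1 (2 * s) = g2 (2 * s - 1)"
      unfolding \<open>s = 1/2\<close> using eq by simp
  qed (auto simp: U)
  then show ?thesis
    unfolding U by (rule parallel_on_cong) (auto simp: joinpaths_def)
qed

lemma parallel_on_reversepath:
  assumes "parallel_on {0..1} \<gamma> g"
  shows "parallel_on {0..1} (reversepath \<gamma>) (reversepath g)"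
proof -
  have "parallel_on {0..1} (\<gamma> \<circ> (\<lambda>s. 1 - s)) (g \<circ> (\<lambda>s. 1 - s))"
    by (rule parallel_on_compose [OF assms]) (auto intro!: continuous_intros)
  then show ?thesis
    by (rule parallel_on_cong) (auto simp: reversepath_def)
qed

section \<open>Trivialization over rectangles; existence and homotopy invariance of parallel
  transport\<close>

text \<open>The pulled back local system has a global frame. No value is prescribed, so adjacent
  pieces can be glued without keeping track of base points.\<close>

definition trivial_over :: "'p::topological_space set \<Rightarrow> ('p \<Rightarrow> 'x) \<Rightarrow> bool" where
  "trivial_over A h \<longleftrightarrow> (\<exists>g. parallel_on A h g \<and> (\<forall>p\<in>A. invertible (g p)))"

text \<open>A constant right factor makes the section over \<open>B\<close> agree with the one over
  \<open>A\<close> at one point; connectedness of the intersection spreads the agreement, and gluing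
  applies.\<close>

lemma trivial_over_Un:
  assumes triv: "trivial_over A h" "trivial_over B h" and cl: "closed A" "closed B"
    and h: "continuous_on (A \<union> B) h" and conn: "connected (A \<inter> B)" and ne: "A \<inter> B \<noteq> {}"
  shows "trivial_over (A \<union> B) h"
proof -
  obtain g1 g2 where g1: "parallel_on A h g1" "\<forall>p\<in>A. invertible (g1 p)"
    and g2: "parallel_on B h g2" "\<forall>p\<in>B. invertible (g2 p)"
    using triv unfolding trivial_over_def by blast
  obtain r where r: "r \<in> A" "r \<in> B"
    using ne by blast
  obtain R where R: "g2 r ** R = mat 1" "R ** g2 r = mat 1"
    using g2(2) r unfolding invertible_def by blast
  then have invR: "invertible R"
    unfolding invertible_def by blast
  define g3 where "g3 p = g2 p ** (R ** g1 r)" for p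
  have g3: "parallel_on B h g3"
    unfolding g3_def using g2(1) by (rule parallel_on_mult)
  have inv3: "invertible (g3 p)" if "p \<in> B" for p
    using g2(2) g1(2) invR r that by (auto simp: g3_def intro!: invertible_mult)
  have "g3 r = g1 r"
    by (simp add: g3_def matrix_mul_assoc R)
  then have "g1 p = g3 p" if "p \<in> A" "p \<in> B" for p
    using parallel_on_unique [of "A \<inter> B" h g1 g3 r p] that r conn
      parallel_on_subset [OF g1(1)] parallel_on_subset [OF g3] continuous_on_subset [OF h]
    by (metis IntI Int_lower1 Int_lower2 le_supI1)
  then have "parallel_on (A \<union> B) h (\<lambda>p. if p \<in> A then g1 p else g3 p)"
    by (intro parallel_on_glue [OF g1(1) g3 cl h])
  moreover have "\<forall>p\<in>A \<union> B. invertible (if p \<in> A then g1 p else g3 p)"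
    using g1(2) inv3 by auto
  ultimately show ?thesis
    unfolding trivial_over_def by blast
qed

text \<open>Bisection in each coordinate in turn: small rectangles map into one frame domain, and
  adjacent rectangles share an edge, which is connected. \<open>h\<close> lives on the whole plane
  so that small rectangles sticking out of the given one need no separate treatment.\<close>

lemma trivial_over_rectangle:
  fixes h :: "real \<times> real \<Rightarrow> 'x"
  assumes h: "continuous_on UNIV h" and X: "range h \<subseteq> X" and ab: "a \<le> b" "c \<le> d"
  shows "trivial_over ({a..b} \<times> {c..d}) h"
proof -
  have local_triv: "\<exists>e>0. \<forall>a b c d. a \<le> s \<and> s \<le> b \<and> b - a < e \<and> c \<le> t \<and> t \<le> d \<and> d - c < e \<longrightarrow>
      trivial_over ({a..b} \<times> {c..d}) h" for s t
  proof -
    obtain U \<Phi> where U: "frame U \<Phi>" "h (s, t) \<in> U"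
      using frame_exists X by blast
    have "open (h -` U)"
      using frame_open [OF U(1)] h by (auto simp: continuous_on_open_vimage)
    then obtain e where e: "e > 0" "ball (s, t) e \<subseteq> h -` U"
      using U(2) openE by blast
    show ?thesis
    proof (intro exI [of _ "e / 2"] conjI allI impI)
      fix a b c d
      assume *: "a \<le> s \<and> s \<le> b \<and> b - a < e / 2 \<and> c \<le> t \<and> t \<le> d \<and> d - c < e / 2"
      have "(x, y) \<in> ball (s, t) e" if "x \<in> {a..b}" "y \<in> {c..d}" for x y
      proof -
        have "dist (s, t) (x, y) \<le> dist s x + dist t y"
          by (simp add: dist_Pair_Pair sqrt_sum_squares_le_sum)
        also have "\<dots> < e"
          using * that by (auto simp: dist_real_def)
        finally show ?thesis by simp
      qed
      then have sub: "h ` ({a..b} \<times> {c..d}) \<subseteq> U"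
        using e(2) by fastforce
      have "parallel_on ({a..b} \<times> {c..d}) h (\<lambda>p. \<Phi> (h p) ** mat 1)"
        using U(1) sub by (rule parallel_on_in_frame)
      moreover have "\<forall>p\<in>{a..b} \<times> {c..d}. invertible (\<Phi> (h p) ** mat 1)"
        using frame_invertible [OF U(1)] sub by (auto simp: image_subset_iff)
      ultimately show "trivial_over ({a..b} \<times> {c..d}) h"
        unfolding trivial_over_def by blast
    qed (use e in simp)
  qed
  \<comment> \<open>The width \<open>e\<close> is part of the bisected property, so that joining two
    pieces only costs the minimum of their widths.\<close>
  have strip: "\<exists>e>0. \<forall>a b. a \<le> s \<and> s \<le> b \<and> b - a < e \<longrightarrow> trivial_over ({a..b} \<times> {c..d}) h" for s
    using \<open>c \<le> d\<close>
  proof (induction rule: Bolzano)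
    case (trans c d e)
    then obtain r1 r2 where "r1 > 0" "r2 > 0"
      and r1: "\<forall>a b. a \<le> s \<and> s \<le> b \<and> b - a < r1 \<longrightarrow> trivial_over ({a..b} \<times> {c..d}) h"
      and r2: "\<forall>a b. a \<le> s \<and> s \<le> b \<and> b - a < r2 \<longrightarrow> trivial_over ({a..b} \<times> {d..e}) h"
      by blast
    show ?case
    proof (intro exI [of _ "min r1 r2"] conjI allI impI)
      fix a b assume ab: "a \<le> s \<and> s \<le> b \<and> b - a < min r1 r2"
      have eq: "{a..b} \<times> {c..d} \<union> {a..b} \<times> {d..e} = {a..b} \<times> {c..e}"
        and int: "{a..b} \<times> {c..d} \<inter> {a..b} \<times> {d..e} = {a..b} \<times> {d}"
        using trans by auto
      have "trivial_over ({a..b} \<times> {c..d} \<union> {a..b} \<times> {d..e}) h"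
        using ab r1 r2
        by (intro trivial_over_Un)
          (auto simp: int intro!: closed_Times connected_Times continuous_on_subset [OF h])
      then show "trivial_over ({a..b} \<times> {c..e}) h"
        by (simp only: eq)
    qed (use \<open>r1 > 0\<close> \<open>r2 > 0\<close> in simp)
  next
    case (local t)
    obtain e where "e > 0" and e: "\<forall>a b c d. a \<le> s \<and> s \<le> b \<and> b - a < e \<and> c \<le> t \<and> t \<le> d \<and> d - c < e \<longrightarrow>
      trivial_over ({a..b} \<times> {c..d}) h"
      using local_triv [of s t] by blast
    then show ?case by blast
  qed
  from \<open>a \<le> b\<close> show ?thesis
  proof (induction rule: Bolzano)
    case (trans a b e)
    have eq: "{a..b} \<times> {c..d} \<union> {b..e} \<times> {c..d} = {a..e} \<times> {c..d}"
      and int: "{a..b} \<times> {c..d} \<inter> {b..e} \<times> {c..d} = {b} \<times> {c..d}"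
      using trans by auto
    have "trivial_over ({a..b} \<times> {c..d} \<union> {b..e} \<times> {c..d}) h"
      using trans ab
      by (intro trivial_over_Un)
        (auto simp: int intro!: closed_Times connected_Times continuous_on_subset [OF h])
    then show ?case
      by (simp only: eq)
  next
    case (local s)
    show ?case by (rule strip)
  qed
qed

lemma parallel_on_square_exists:
  fixes h :: "real \<times> real \<Rightarrow> 'x"
  assumes h: "continuous_on ({0..1} \<times> {0..1}) h" and X: "h ` ({0..1} \<times> {0..1}) \<subseteq> X"
  obtains g where "parallel_on ({0..1} \<times> {0..1}) h g" "g (0, 0) = M"
proof -
  \<comment> \<open>The retraction of the line onto the unit interval; applied in both coordinates,
    it extends \<open>h\<close> to the plane without leaving \<open>X\<close>.\<close>
  define c :: "real \<Rightarrow> real" where "c s = max 0 (min 1 s)" for s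
  define h' where "h' = h \<circ> (\<lambda>(s, t). (c s, c t))"
  have c: "c s \<in> {0..1}" "s \<in> {0..1} \<Longrightarrow> c s = s" for s
    by (auto simp: c_def)
  have "continuous_on UNIV h'"
    unfolding h'_def
    by (rule continuous_on_compose, unfold case_prod_unfold c_def)
      (auto intro!: continuous_intros continuous_on_subset [OF h])
  moreover have "range h' \<subseteq> X"
    using X c(1) by (auto simp: h'_def image_subset_iff)
  ultimately have "trivial_over ({0..1} \<times> {0..1}) h'"
    by (rule trivial_over_rectangle) auto
  then obtain g where g: "parallel_on ({0..1} \<times> {0..1}) h' g"
    "\<forall>p\<in>{0..1} \<times> {0..1}. invertible (g p)"
    unfolding trivial_over_def by blast
  then obtain R where R: "g (0, 0) ** R = mat 1"
    unfolding invertible_def by fastforce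
  have "parallel_on ({0..1} \<times> {0..1}) h' (\<lambda>p. g p ** (R ** M))"
    using g(1) by (rule parallel_on_mult)
  then have "parallel_on ({0..1} \<times> {0..1}) h (\<lambda>p. g p ** (R ** M))"
    by (rule parallel_on_cong) (auto simp: h'_def c(2))
  moreover have "g (0, 0) ** (R ** M) = M"
    by (simp add: matrix_mul_assoc R)
  ultimately show thesis by (rule that)
qed

text \<open>A path is a square that is constant in its second variable, so existence over squares
  covers it.\<close>

lemma parallel_on_path_exists:
  assumes "path \<gamma>" "path_image \<gamma> \<subseteq> X"
  obtains g where "parallel_on {0..1} \<gamma> g" "g 0 = M"
proof -
  have "continuous_on ({0..1} \<times> {0..1}) (\<gamma> \<circ> (fst :: real \<times> real \<Rightarrow> real))"
    using assms(1) unfolding path_def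
    by (intro continuous_on_compose continuous_intros) (auto intro: continuous_on_subset)
  moreover have "(\<gamma> \<circ> (fst :: real \<times> real \<Rightarrow> real)) ` ({0..1} \<times> {0..1}) \<subseteq> X"
    using assms(2) by (auto simp: path_image_def)
  ultimately obtain g where g: "parallel_on ({0..1} \<times> {0..1}) (\<gamma> \<circ> fst) g" "g (0, 0 :: real) = M"
    by (rule parallel_on_square_exists)
  have "parallel_on {0..1} ((\<gamma> \<circ> fst) \<circ> (\<lambda>s. (s, 0 :: real))) (g \<circ> (\<lambda>s. (s, 0)))"
    by (rule parallel_on_compose [OF g(1)]) (auto intro!: continuous_intros)
  then have "parallel_on {0..1} \<gamma> (g \<circ> (\<lambda>s. (s, 0)))"
    by (rule parallel_on_cong) auto
  then show thesis
    using that g(2) by simp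
qed

text \<open>Parallel transport over the two side edges of the square, on which the homotopy is constant,
  is trivial.\<close>

lemma parallel_on_homotopic:
  assumes hom: "homotopic_paths X p q"
    and g1: "parallel_on {0..1} p g1" and g2: "parallel_on {0..1} q g2" and eq: "g1 0 = g2 0"
  shows "g1 1 = g2 1"
proof -
  obtain h where h: "continuous_on ({0..1} \<times> {0..1}) h" "h \<in> ({0..1} \<times> {0..1}) \<rightarrow> X"
    "\<And>x. x \<in> {0..1} \<Longrightarrow> h (0, x) = p x" "\<And>x. x \<in> {0..1} \<Longrightarrow> h (1, x) = q x"
    and ends: "\<And>t. t \<in> {0..1::real} \<Longrightarrow> h (t, 0) = p 0" "\<And>t. t \<in> {0..1::real} \<Longrightarrow> h (t, 1) = p 1"
    using hom unfolding homotopic_paths by (auto simp: pathstart_def pathfinish_def)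
  obtain g where g: "parallel_on ({0..1} \<times> {0..1}) h g" "g (0, 0) = g1 0"
    using parallel_on_square_exists h by (metis funcset_image)
  have edge: "parallel_on {0..1} (h \<circ> f) (g \<circ> f)"
    if "continuous_on {0..1} f" "f ` {0..1} \<subseteq> {0..1} \<times> {0..1}" for f :: "real \<Rightarrow> real \<times> real"
    using g(1) that by (rule parallel_on_compose)
  have pX: "p 0 \<in> X" "p 1 \<in> X"
    using homotopic_paths_imp_subset [OF hom] by (auto simp: path_image_def)
  have cont: "continuous_on {0..1} p" "continuous_on {0..1} q"
    using homotopic_paths_imp_path [OF hom] by (auto simp: path_def)
  have bottom: "g (0, 1) = g1 1"
  proof (rule parallel_on_unique [of "{0..1}" p "\<lambda>x. g (0, x)" g1 0 1])
    show "parallel_on {0..1} p (\<lambda>x. g (0, x))"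
      by (rule parallel_on_cong [OF edge [of "\<lambda>x. (0, x)"]])
        (auto simp: h(3) intro!: continuous_intros)
  qed (use g1 g(2) cont in auto)
  have left: "g (1, 0) = g1 0"
  proof (rule parallel_on_unique [of "{0..1}" "\<lambda>_. p 0" "\<lambda>x. g (x, 0)" "\<lambda>_. g1 0" 0 1])
    show "parallel_on {0..1} (\<lambda>_. p 0) (\<lambda>x. g (x, 0))"
      by (rule parallel_on_cong [OF edge [of "\<lambda>x. (x, 0)"]])
        (auto simp: ends intro!: continuous_intros)
  qed (use pX g(2) in \<open>auto intro: parallel_on_const\<close>)
  have right: "g (1, 1) = g (0, 1)"
  proof (rule parallel_on_unique [of "{0..1}" "\<lambda>_. p 1" "\<lambda>x. g (x, 1)" "\<lambda>_. g (0, 1)" 0 1])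
    show "parallel_on {0..1} (\<lambda>_. p 1) (\<lambda>x. g (x, 1))"
      by (rule parallel_on_cong [OF edge [of "\<lambda>x. (x, 1)"]])
        (auto simp: ends intro!: continuous_intros)
  qed (use pX in \<open>auto intro: parallel_on_const\<close>)
  have "g (1, 1) = g2 1"
  proof (rule parallel_on_unique [of "{0..1}" q "\<lambda>x. g (1, x)" g2 0 1])
    show "parallel_on {0..1} q (\<lambda>x. g (1, x))"
      by (rule parallel_on_cong [OF edge [of "\<lambda>x. (1, x)"]])
        (auto simp: h(4) intro!: continuous_intros)
  qed (use g2 left eq cont in auto)
  with bottom right show ?thesis by simp
qed

end

section \<open>Linear differential equations with holomorphic coefficients\<close>

definition matrix_derivative_at ::
  "(complex \<Rightarrow> complex ^ 'k ^ 'm) \<Rightarrow> complex ^ 'k ^ 'm \<Rightarrow> complex \<Rightarrow> bool" where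
  "matrix_derivative_at f D w \<longleftrightarrow>
     (\<forall>i k. ((\<lambda>w. f w $ i $ k) has_field_derivative D $ i $ k) (at w))"

section \<open>Power series solutions\<close>

text \<open>Cauchy's estimate: the terms at a radius \<open>r\<close> inside the disc of convergence
  are bounded by \<open>C\<close>. The exponent \<open>n + 1\<close> leaves one factor
  \<open>K\<close> to absorb \<open>C\<close>.\<close>

lemma fps_nth_geometric_bound:
  fixes f :: "complex fps"
  assumes "fps_conv_radius f > 0"
  shows "\<exists>K\<ge>1. \<forall>n. norm (fps_nth f n) \<le> K ^ (n + 1)"
proof -
  obtain r where r: "0 < ereal r" "ereal r < fps_conv_radius f"
    using ereal_dense2 [OF assms] by blast
  then have "summable (\<lambda>n. norm (fps_nth f n * of_real r ^ n))"
    by (intro abs_summable_in_conv_radius) (simp add: fps_conv_radius_def)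
  then have "Bseq (\<lambda>n. norm (fps_nth f n * of_real r ^ n))"
    by (intro convergent_imp_Bseq summable_imp_convergent) 
      (auto simp: convergent_def dest: summable_LIMSEQ_zero)
  then obtain C where C: "C > 0" "\<And>n. norm (fps_nth f n * of_real r ^ n) \<le> C"
    by (auto simp: Bseq_def)
  define K where "K = max 1 (max C (1 / r))"
  have r0: "r > 0" using r by simp
  have "norm (fps_nth f n) \<le> K ^ (n + 1)" for n
  proof -
    have "norm (fps_nth f n) * r ^ n \<le> C"
      using C(2) [of n] r0 by (simp add: norm_mult norm_power)
    then have "norm (fps_nth f n) \<le> C * (1 / r) ^ n"
      using r0 by (simp add: field_simps)
    also have "\<dots> \<le> K * K ^ n"
      using r0 C(1) by (intro mult_mono power_mono) (auto simp: K_def)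
    finally show ?thesis by simp
  qed
  then show ?thesis
    by (intro exI [of _ K]) (auto simp: K_def)
qed

text \<open>Comparing coefficients in \<open>P' = B P\<close>, \<open>P 0 = 1\<close>, where
  \<open>b i l\<close> expands the entry \<open>B $ i $ l\<close>: the coefficient of order
  \<open>n + 1\<close>, times \<open>n + 1\<close>, is the Cauchy product of order
  \<open>n\<close>.\<close>

fun ode_coeff :: "('k::finite \<Rightarrow> 'k \<Rightarrow> complex fps) \<Rightarrow> nat \<Rightarrow> complex ^ 'k ^ 'k" where
  "ode_coeff b 0 = mat 1"
| "ode_coeff b (Suc n) =
     (\<chi> i k. (\<Sum>m\<le>n. \<Sum>l\<in>UNIV. fps_nth (b i l) m * ode_coeff b (n - m) $ l $ k) / of_nat (Suc n))"

text \<open>For \<open>n > 0\<close> the recursion has \<open>n\<close> summands over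
  \<open>m\<close>, each at most \<open>L ^ n\<close> with \<open>L = CARD('k) * K\<close>; their
  number cancels against the division by \<open>n\<close>. The factor \<open>CARD('k)\<close> pays
  for the matrix product.\<close>

lemma norm_ode_coeff_le:
  fixes b :: "'k::finite \<Rightarrow> 'k \<Rightarrow> complex fps"
  assumes K: "K \<ge> 1" "\<And>i l n. norm (fps_nth (b i l) n) \<le> K ^ (n + 1)"
  shows "norm (ode_coeff b n $ i $ k) \<le> (real CARD('k) * K) ^ n"
proof (induction n arbitrary: i k rule: less_induct)
  case (less n)
  define N where "N = real CARD('k)"
  define L where "L = N * K"
  have N: "N \<ge> 1"
    unfolding N_def by (simp add: Suc_leI)
  then have L: "L \<ge> K"
    using K mult_right_mono [of 1 N K] by (simp add: L_def)
  show ?case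
  proof (cases n)
    case 0
    then show ?thesis by (simp add: mat_def)
  next
    case (Suc n')
    have "norm (\<Sum>m\<le>n'. \<Sum>l\<in>UNIV. fps_nth (b i l) m * ode_coeff b (n' - m) $ l $ k)
        \<le> (\<Sum>m\<le>n'. L * L ^ n')"
    proof (rule sum_norm_le)
      fix m assume m: "m \<in> {..n'}"
      have "norm (\<Sum>l\<in>UNIV. fps_nth (b i l) m * ode_coeff b (n' - m) $ l $ k)
          \<le> (\<Sum>l\<in>(UNIV :: 'k set). K ^ (m + 1) * L ^ (n' - m))"
      proof (rule sum_norm_le)
        fix l :: 'k
        have "norm (ode_coeff b (n' - m) $ l $ k) \<le> L ^ (n' - m)"
          unfolding L_def N_def using Suc by (intro less) auto
        then show "norm (fps_nth (b i l) m * ode_coeff b (n' - m) $ l $ k)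
            \<le> K ^ (m + 1) * L ^ (n' - m)"
          unfolding norm_mult using K by (intro mult_mono) auto
      qed
      also have "\<dots> = N * K * (K ^ m * L ^ (n' - m))"
        by (simp add: N_def)
      also have "\<dots> \<le> N * K * (L ^ m * L ^ (n' - m))"
        using L K N by (intro mult_left_mono mult_right_mono power_mono) auto
      also have "\<dots> = L * L ^ n'"
        using m by (simp add: L_def flip: power_add)
      finally show "norm (\<Sum>l\<in>UNIV. fps_nth (b i l) m * ode_coeff b (n' - m) $ l $ k)
          \<le> L * L ^ n'" .
    qed
    also have "\<dots> = real (Suc n') * L ^ n"
      by (simp add: Suc)
    finally show ?thesis
      by (simp add: Suc norm_divide L_def N_def field_simps del: of_nat_Suc)
  qed
qed

lemma matrix_mult_nth: "(A ** B) $ i $ k = (\<Sum>l\<in>UNIV. A $ i $ l * B $ l $ k)"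
  by (simp add: matrix_matrix_mult_def)

lemma linear_ode_local_solution:
  fixes B :: "complex \<Rightarrow> complex ^ 'k::finite ^ 'k"
  assumes B: "\<And>i k. (\<lambda>w. B w $ i $ k) analytic_on {0}"
  obtains P where "P 0 = mat 1" "\<forall>\<^sub>F w in nhds 0. matrix_derivative_at P (B w ** P w) w"
proof -
  have "\<exists>f. (\<lambda>w. B w $ i $ k) has_fps_expansion f" for i k
    using B [of i k] analytic_at_imp_has_fps_expansion_0 by blast
  then obtain b where b: "\<And>i k. (\<lambda>w. B w $ i $ k) has_fps_expansion b i k"
    by metis
  have "\<exists>K\<ge>1. \<forall>n. norm (fps_nth (b i l) n) \<le> K ^ (n + 1)" for i l
    using b [of i l] by (intro fps_nth_geometric_bound) (simp add: has_fps_expansion_def)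
  then obtain K0 where K0: "\<And>i l. K0 i l \<ge> (1::real)"
    "\<And>i l n. norm (fps_nth (b i l) n) \<le> K0 i l ^ (n + 1)"
    by metis
  \<comment> \<open>One bound for all entries, of which there are finitely many.\<close>
  define K where "K = Max (range (\<lambda>(i, l). K0 i l))"
  have K0_le: "K0 i l \<le> K" for i l
    unfolding K_def by (rule Max_ge) (auto intro: image_eqI [of _ _ "(i, l)"])
  have K: "K \<ge> 1"
    using K0(1) K0_le order_trans by blast
  have bK: "norm (fps_nth (b i l) n) \<le> K ^ (n + 1)" for i l n
  proof -
    have "K0 i l ^ (n + 1) \<le> K ^ (n + 1)"
      using K0(1) [of i l] by (intro power_mono K0_le) simp
    with K0(2) [of i l n] show ?thesis by (rule order_trans)
  qed
  define L where "L = real CARD('k) * K"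
  have L: "L > 0"
    unfolding L_def using K by simp
  define p where "p i k = Abs_fps (\<lambda>n. ode_coeff b n $ i $ k)" for i k
  have rad: "fps_conv_radius (p i k) > 0" for i k
  proof -
    \<comment> \<open>At radius \<open>1 / (2 * L)\<close> the series is dominated by a geometric
      series of ratio 1/2.\<close>
    have "summable (\<lambda>n. ode_coeff b n $ i $ k * of_real (1 / (2 * L)) ^ n)"
    proof (rule summable_comparison_test')
      show "summable (\<lambda>n. (1 / 2 :: real) ^ n)"
        by (rule summable_geometric) simp
      fix n
      have "norm (ode_coeff b n $ i $ k) \<le> L ^ n"
        unfolding L_def using K bK by (rule norm_ode_coeff_le)
      then have "norm (ode_coeff b n $ i $ k * of_real (1 / (2 * L)) ^ n) \<le> L ^ n * (1 / (2 * L)) ^ n"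
        unfolding norm_mult norm_power norm_of_real using L by (intro mult_mono) auto
      also have "\<dots> = (1 / 2) ^ n"
        using L by (simp flip: power_mult_distrib)
      finally show "norm (ode_coeff b n $ i $ k * of_real (1 / (2 * L)) ^ n) \<le> (1 / 2) ^ n" .
    qed
    then have "ereal (norm (of_real (1 / (2 * L)) :: complex)) \<le> conv_radius (\<lambda>n. ode_coeff b n $ i $ k)"
      by (rule conv_radius_geI)
    moreover have "0 < ereal (norm (of_real (1 / (2 * L)) :: complex))"
      using L by simp
    ultimately have "0 < conv_radius (\<lambda>n. ode_coeff b n $ i $ k)"
      by (rule less_le_trans [rotated])
    then show ?thesis
      by (simp add: p_def fps_conv_radius_def)
  qed
  define P where "P w = (\<chi> i k. eval_fps (p i k) w)" for w
  have deriv_p: "fps_deriv (p i k) = (\<Sum>l\<in>UNIV. b i l * p l k)" for i k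
  proof (rule fps_ext)
    fix n
    have "fps_nth (fps_deriv (p i k)) n =
        (\<Sum>m\<le>n. \<Sum>l\<in>UNIV. fps_nth (b i l) m * ode_coeff b (n - m) $ l $ k)"
      by (simp add: p_def del: of_nat_Suc)
    also have "\<dots> = (\<Sum>l\<in>UNIV. \<Sum>m\<le>n. fps_nth (b i l) m * ode_coeff b (n - m) $ l $ k)"
      by (rule sum.swap)
    also have "\<dots> = fps_nth (\<Sum>l\<in>UNIV. b i l * p l k) n"
      by (simp add: fps_sum_nth fps_mult_nth p_def atMost_atLeast0)
    finally show "fps_nth (fps_deriv (p i k)) n = fps_nth (\<Sum>l\<in>UNIV. b i l * p l k) n" .
  qed
  show thesis
  proof (rule that)
    show "P 0 = mat 1"
      by (simp add: P_def vec_eq_iff eval_fps_at_0 p_def)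
    have exp: "(\<lambda>w. \<Sum>l\<in>UNIV. B w $ i $ l * P w $ l $ k) has_fps_expansion fps_deriv (p i k)" for i k
      unfolding deriv_p P_def using b eval_fps_has_fps_expansion [OF rad]
      by (auto intro!: has_fps_expansion_sum has_fps_expansion_mult)
    have "\<forall>\<^sub>F w in nhds 0. ((\<lambda>w. P w $ i $ k) has_field_derivative (B w ** P w) $ i $ k) (at w)"
      for i k
    proof -
      have "\<forall>\<^sub>F w in nhds 0. w \<in> eball 0 (fps_conv_radius (p i k))"
        using rad by (intro eventually_nhds_in_open) (auto simp: zero_ereal_def)
      moreover have "\<forall>\<^sub>F w in nhds 0. eval_fps (fps_deriv (p i k)) w =
          (\<Sum>l\<in>UNIV. B w $ i $ l * P w $ l $ k)"
        using exp by (simp add: has_fps_expansion_def)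
      ultimately show ?thesis
      proof eventually_elim
        case (elim w)
        have "(eval_fps (p i k) has_field_derivative eval_fps (fps_deriv (p i k)) w) (at w)"
          using elim(1) by (intro has_field_derivative_eval_fps) (simp add: in_eball_iff)
        then show ?case
          by (simp add: elim(2) P_def matrix_matrix_mult_def)
      qed
    qed
    then show "\<forall>\<^sub>F w in nhds 0. matrix_derivative_at P (B w ** P w) w"
      unfolding matrix_derivative_at_def by (intro eventually_all_finite)
  qed
qed

text \<open>Multiplying by a solution of the adjoint equation \<open>R' = - R B\<close> turns solutions into
  constants.\<close>

lemma linear_ode_fundamental_solution:
  fixes B :: "complex \<Rightarrow> complex ^ 'k::finite ^ 'k"
  assumes B: "\<And>i k. (\<lambda>w. B w $ i $ k) analytic_on {0}"
  obtains P where "P 0 = mat 1" "\<forall>\<^sub>F w in nhds 0. matrix_derivative_at P (B w ** P w) w"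
    "\<forall>\<^sub>F w in nhds 0. invertible (P w)"
    "\<And>f :: complex \<Rightarrow> complex ^ 'k ^ 'k. \<forall>\<^sub>F w in nhds 0. matrix_derivative_at f (B w ** f w) w \<Longrightarrow>
       \<forall>\<^sub>F w in nhds 0. f w = P w ** f 0"
proof -
  obtain P where P: "P 0 = mat 1" "\<forall>\<^sub>F w in nhds 0. matrix_derivative_at P (B w ** P w) w"
    using B by (rule linear_ode_local_solution)
  have "(\<lambda>w. (\<chi> i k. - B w $ k $ i) $ i $ k) analytic_on {0}" for i k
    using B by (auto intro!: analytic_intros)
  then obtain T where T: "T 0 = mat 1"
    "\<forall>\<^sub>F w in nhds 0. matrix_derivative_at T ((\<chi> i k. - B w $ k $ i) ** T w) w"
    by (rule linear_ode_local_solution)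
  \<comment> \<open>Transposition turns the equation for \<open>T\<close>, whose coefficient is
    minus the transpose of \<open>B\<close> on the left, into the adjoint equation with
    \<open>B\<close> on the right.\<close>
  define R where "R w = transpose (T w)" for w
  have R0: "R 0 = mat 1"
    by (simp add: R_def T(1) transpose_mat)
  have R: "\<forall>\<^sub>F w in nhds 0. matrix_derivative_at R (- (R w ** B w)) w"
    using T(2)
  proof eventually_elim
    case (elim w)
    show ?case
      unfolding matrix_derivative_at_def
    proof (intro allI)
      fix i k
      have "((\<lambda>w. T w $ k $ i) has_field_derivative ((\<chi> i k. - B w $ k $ i) ** T w) $ k $ i) (at w)"
        using elim unfolding matrix_derivative_at_def by blast
      then show "((\<lambda>w. R w $ i $ k) has_field_derivative (- (R w ** B w)) $ i $ k) (at w)"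
        by (simp add: R_def transpose_def matrix_matrix_mult_def sum_negf mult.commute)
    qed
  qed
  have const: "\<forall>\<^sub>F w in nhds 0. R w ** f w = f 0"
    if f: "\<forall>\<^sub>F w in nhds 0. matrix_derivative_at f (B w ** f w) w" for f :: "complex \<Rightarrow> complex ^ 'k ^ 'k"
  proof -
    have "\<forall>\<^sub>F w in nhds 0. \<forall>i k. ((\<lambda>w. (R w ** f w) $ i $ k) has_field_derivative 0) (at w)"
      using f R
    proof eventually_elim
      case (elim w)
      show ?case
      proof (intro allI)
        fix i k
        have "((\<lambda>w. \<Sum>l\<in>UNIV. R w $ i $ l * f w $ l $ k) has_field_derivative
            (\<Sum>l\<in>UNIV. (- (R w ** B w)) $ i $ l * f w $ l $ k + (B w ** f w) $ l $ k * R w $ i $ l)) (at w)"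
          using elim unfolding matrix_derivative_at_def
          by (intro DERIV_sum DERIV_mult) auto
        also have "(\<Sum>l\<in>UNIV. (- (R w ** B w)) $ i $ l * f w $ l $ k + (B w ** f w) $ l $ k * R w $ i $ l)
            = (R w ** (B w ** f w)) $ i $ k - (R w ** B w ** f w) $ i $ k"
          by (simp add: matrix_mult_nth sum.distrib sum_subtractf sum_negf mult.commute)
        also have "\<dots> = 0"
          by (simp add: matrix_mul_assoc)
        finally show "((\<lambda>w. (R w ** f w) $ i $ k) has_field_derivative 0) (at w)"
          by (simp add: matrix_matrix_mult_def)
      qed
    qed
    then obtain e where e: "e > 0" and
      d0: "\<And>w i k. w \<in> ball 0 e \<Longrightarrow> ((\<lambda>w. (R w ** f w) $ i $ k) has_field_derivative 0) (at w)"
      unfolding eventually_nhds_metric by (auto simp: dist_commute)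
    have "R w ** f w = f 0" if w: "w \<in> ball 0 e" for w
    proof -
      have "(R w ** f w) $ i $ k = (R 0 ** f 0) $ i $ k" for i k
      proof -
        have "\<exists>c. \<forall>x\<in>ball 0 e. (R x ** f x) $ i $ k = c"
          by (rule has_field_derivative_zero_constant, simp,
              rule has_field_derivative_at_within [OF d0])
        then show ?thesis
          using w e by (metis centre_in_ball)
      qed
      then show ?thesis
        by (simp add: vec_eq_iff R0)
    qed
    then show ?thesis
      using e by (auto simp: eventually_nhds_metric dist_commute)
  qed
  \<comment> \<open>For \<open>f = P\<close> the constant is the identity, so \<open>R\<close>
    inverts \<open>P\<close> near 0.\<close>
  have RP: "\<forall>\<^sub>F w in nhds 0. R w ** P w = mat 1"
    using const [OF P(2)] P(1) by simp
  show thesis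
  proof (rule that [of P])
    show "\<forall>\<^sub>F w in nhds 0. invertible (P w)"
      using RP by eventually_elim (auto simp: invertible_left_inverse)
    fix f :: "complex \<Rightarrow> complex ^ 'k ^ 'k"
    assume "\<forall>\<^sub>F w in nhds 0. matrix_derivative_at f (B w ** f w) w"
    from const [OF this] RP show "\<forall>\<^sub>F w in nhds 0. f w = P w ** f 0"
    proof eventually_elim
      case (elim w)
      then have "P w ** R w = mat 1"
        by (simp add: matrix_left_right_inverse)
      then show ?case
        by (simp add: matrix_mul_assoc flip: elim(1))
    qed
  qed (use P in auto)
qed

section \<open>Charts of the sphere\<close>

text \<open>Centred at \<open>z\<close> for every \<open>z\<close>, infinity included, so that every
  local question is about the point 0, where the power series method applies.\<close>

definition sphere_chart :: "riemann_sphere \<Rightarrow> complex \<Rightarrow> riemann_sphere" where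
  "sphere_chart z w = (case z of Fin a \<Rightarrow> Fin (a + w) | Infty \<Rightarrow> chart_at_Infty w)"

lemma sphere_chart_simps [simp]:
  "sphere_chart (Fin a) w = Fin (a + w)"
  "sphere_chart Infty w = chart_at_Infty w"
  "sphere_chart z 0 = z"
  by (auto simp: sphere_chart_def chart_at_Infty_def split: riemann_sphere.split)

lemma open_Fin_vimage: "open U \<Longrightarrow> open (Fin -` U)"
  by (simp add: open_riemann_sphere_def)

lemma open_Fin_image: "open V \<Longrightarrow> open (Fin ` V)"
  by (auto simp: open_riemann_sphere_def inj_vimage_image_eq inj_on_def)

lemma continuous_on_Fin: "continuous_on A Fin"
  by (rule continuous_on_subset [of UNIV]) (auto simp: continuous_on_open_vimage open_Fin_vimage)

lemma eventually_nhds_Fin: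
  "eventually P (nhds (Fin a)) \<longleftrightarrow> eventually (\<lambda>x. P (Fin x)) (nhds a)"
proof
  assume "eventually P (nhds (Fin a))"
  then obtain U where "open U" "Fin a \<in> U" "\<forall>z\<in>U. P z"
    unfolding eventually_nhds by blast
  then show "eventually (\<lambda>x. P (Fin x)) (nhds a)"
    unfolding eventually_nhds by (intro exI [of _ "Fin -` U"]) (auto intro: open_Fin_vimage)
next
  assume "eventually (\<lambda>x. P (Fin x)) (nhds a)"
  then obtain V where "open V" "a \<in> V" "\<forall>x\<in>V. P (Fin x)"
    unfolding eventually_nhds by blast
  then show "eventually P (nhds (Fin a))"
    unfolding eventually_nhds by (intro exI [of _ "Fin ` V"]) (auto intro: open_Fin_image)
qed

text \<open>Inversion exchanges small discs about 0 with complements of large discs; the compact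
  complement of an open neighbourhood of infinity is bounded, which supplies the radius.\<close>

lemma eventually_nhds_Infty:
  "eventually P (nhds Infty) \<longleftrightarrow> eventually (\<lambda>w. P (chart_at_Infty w)) (nhds 0)"
proof
  assume "eventually P (nhds Infty)"
  then obtain U where U: "open U" "Infty \<in> U" "\<And>z. z \<in> U \<Longrightarrow> P z"
    unfolding eventually_nhds by blast
  then have "bounded (- (Fin -` U))"
    by (auto simp: open_riemann_sphere_def compact_imp_bounded)
  then obtain b where b: "b > 0" "\<And>x. x \<in> - (Fin -` U) \<Longrightarrow> norm x \<le> b"
    unfolding bounded_pos by auto
  have "chart_at_Infty w \<in> U" if "dist w 0 < 1 / b" for w
  proof (cases "w = 0")
    case False
    then have "norm (1 / w) > b"
      using that b(1) by (simp add: norm_divide field_simps)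
    then have "1 / w \<in> Fin -` U"
      using b(2) [of "1 / w"] by (meson ComplI not_less)
    then show ?thesis
      using False by (simp add: chart_at_Infty_def)
  qed (use U in \<open>simp add: chart_at_Infty_def\<close>)
  then show "eventually (\<lambda>w. P (chart_at_Infty w)) (nhds 0)"
    unfolding eventually_nhds_metric using b(1) U(3) by (intro exI [of _ "1 / b"]) auto
next
  assume "eventually (\<lambda>w. P (chart_at_Infty w)) (nhds 0)"
  then obtain e where e: "e > 0" "\<And>w. norm w < e \<Longrightarrow> P (chart_at_Infty w)"
    unfolding eventually_nhds_metric by auto
  define U where "U = insert Infty (Fin ` (- cball 0 (1 / e)))"
  have vU: "Fin -` U = - cball 0 (1 / e)"
    by (auto simp: U_def)
  have "open U"
    unfolding open_riemann_sphere_def vU by (simp add: open_Compl)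
  moreover have "P z" if "z \<in> U" for z
  proof (cases z)
    case (Fin x)
    then have x: "norm x > 1 / e"
      using that by (auto simp: U_def)
    then have "x \<noteq> 0"
      using e(1) by auto
    then have "norm (1 / x) < e"
      using x e(1) by (simp add: norm_divide field_simps)
    then show ?thesis
      using e(2) [of "1 / x"] \<open>x \<noteq> 0\<close> by (simp add: chart_at_Infty_def Fin)
  next
    case Infty
    then show ?thesis
      using e(1) e(2) [of 0] by (simp add: chart_at_Infty_def)
  qed
  ultimately show "eventually P (nhds Infty)"
    unfolding eventually_nhds by (intro exI [of _ U]) (auto simp: U_def)
qed

lemma eventually_nhds_shift:
  fixes a :: "'a::real_normed_vector"
  shows "eventually P (nhds a) \<longleftrightarrow> eventually (\<lambda>w. P (a + w)) (nhds 0)"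
proof -
  have "nhds a = filtermap (\<lambda>w. a + w) (nhds 0)"
    using filtermap_nhds_shift [of "- a" 0] by (simp add: add.commute)
  then show ?thesis
    by (simp only: eventually_filtermap)
qed

lemma eventually_nhds_sphere_chart:
  "eventually P (nhds z) \<longleftrightarrow> eventually (\<lambda>w. P (sphere_chart z w)) (nhds 0)"
proof (cases z)
  case (Fin a)
  then show ?thesis
    using eventually_nhds_shift [of "\<lambda>x. P (Fin x)" a] by (simp add: eventually_nhds_Fin)
qed (simp add: eventually_nhds_Infty)

lemma sphere_analytic_at_chart:
  "sphere_analytic_at F z \<longleftrightarrow> (\<forall>i k. (\<lambda>w. F (sphere_chart z w) $ i $ k) analytic_on {0})"
proof (cases z)
  case (Fin a)
  have iff: "(\<lambda>x. f (Fin x)) analytic_on {a} \<longleftrightarrow> (\<lambda>w. f (Fin (a + w))) analytic_on {0}"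
    for f :: "riemann_sphere \<Rightarrow> complex"
  proof
    assume "(\<lambda>x. f (Fin x)) analytic_on {a}"
    then have "(\<lambda>x. f (Fin x)) \<circ> (\<lambda>w. a + w) analytic_on {0}"
      by (intro analytic_on_compose_gen [where T = "{a}"]) (auto intro!: analytic_intros)
    then show "(\<lambda>w. f (Fin (a + w))) analytic_on {0}"
      by (simp add: comp_def)
  next
    assume "(\<lambda>w. f (Fin (a + w))) analytic_on {0}"
    then have "(\<lambda>w. f (Fin (a + w))) \<circ> (\<lambda>x. x - a) analytic_on {a}"
      by (intro analytic_on_compose_gen [where T = "{0}"]) (auto intro!: analytic_intros)
    then show "(\<lambda>x. f (Fin x)) analytic_on {a}"
      by (simp add: comp_def)
  qed
  show ?thesis
    using iff [of "\<lambda>z. F z $ _ $ _"] by (simp add: sphere_analytic_at_def Fin)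
qed (simp add: sphere_analytic_at_def)

text \<open>Separation makes compact images of paths and homotopies closed, so that poles off such
  an image have a whole neighbourhood off it.\<close>

instance riemann_sphere :: t2_space
proof
  have sep: "\<exists>U V. open U \<and> open V \<and> Fin a \<in> U \<and> Infty \<in> V \<and> U \<inter> V = {}" for a
  proof (rule exI [of _ "Fin ` ball a 1"], rule exI [of _ "insert Infty (Fin ` (- cball a 1))"],
      intro conjI)
    have vU: "Fin -` insert Infty (Fin ` (- cball a 1)) = - cball a 1"
      by auto
    show "open (insert Infty (Fin ` (- cball a 1)))"
      unfolding open_riemann_sphere_def vU by (simp add: open_Compl)
    show "open (Fin ` ball a 1)"
      by (simp add: open_Fin_image)
  qed auto
  have sep_Fin: "\<exists>U V. open U \<and> open V \<and> Fin a \<in> U \<and> Fin b \<in> V \<and> U \<inter> V = {}"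
    if ab: "a \<noteq> b" for a b
  proof -
    obtain U V where "open U" "open V" "a \<in> U" "b \<in> V" "U \<inter> V = {}"
      using hausdorff [OF ab] by metis
    then have "open (Fin ` U)" "open (Fin ` V)" "Fin a \<in> Fin ` U" "Fin b \<in> Fin ` V"
      "Fin ` U \<inter> Fin ` V = {}"
      by (auto simp: open_Fin_image)
    then show ?thesis by blast
  qed
  fix x y :: riemann_sphere
  assume "x \<noteq> y"
  then show "\<exists>U V. open U \<and> open V \<and> x \<in> U \<and> y \<in> V \<and> U \<inter> V = {}"
  proof (cases x; cases y)
    fix b assume "x = Infty" "y = Fin b"
    then show ?thesis using sep [of b] by (metis Int_commute)
  qed (use sep sep_Fin in simp_all)
qed

lemma inj_sphere_chart: "inj (sphere_chart z)"
  by (cases z) (auto simp: inj_def chart_at_Infty_def split: if_splits)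

text \<open>Continuity of the chart at an arbitrary point and not only at its centre; it moves a
  germ at \<open>sphere_chart z w\<close> into the chart at \<open>z\<close>.\<close>

lemma eventually_sphere_chart_at:
  assumes "eventually P (nhds (sphere_chart z w))"
  shows "\<forall>\<^sub>F v in nhds w. P (sphere_chart z v)"
proof -
  have finite: "\<forall>\<^sub>F v in nhds w. P (Fin (f v))"
    if P: "eventually P (nhds (Fin (f w)))" and f: "isCont f w" for f :: "complex \<Rightarrow> complex"
  proof -
    have "filterlim f (nhds (f w)) (nhds w)"
      using f by (simp add: isCont_def tendsto_at_iff_tendsto_nhds)
    then show ?thesis
      using P unfolding filterlim_iff eventually_nhds_Fin by blast
  qed
  show ?thesis
  proof (cases z)
    case (Fin a)
    then show ?thesis
      using finite [of "\<lambda>v. a + v"] assms by (simp add: continuous_intros)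
  next
    case Infty
    show ?thesis
    proof (cases "w = 0")
      case True
      then show ?thesis
        using assms by (simp add: Infty chart_at_Infty_def eventually_nhds_Infty)
    next
      case False
      then have "\<forall>\<^sub>F v in nhds w. P (Fin (1 / v))"
        using assms by (intro finite) (auto simp: Infty chart_at_Infty_def intro!: continuous_intros)
      moreover have "\<forall>\<^sub>F v in nhds w. v \<noteq> 0"
        using False by (rule t1_space_nhds)
      ultimately show ?thesis
        by eventually_elim (simp add: Infty chart_at_Infty_def)
    qed
  qed
qed

section \<open>Complex derivatives of matrices and change of chart\<close>

lemma matrix_derivative_at_imp_analytic:
  fixes f :: "complex \<Rightarrow> complex ^ 'k ^ 'm"
  assumes "\<forall>\<^sub>F w in nhds a. matrix_derivative_at f (D w) w"
  shows "(\<lambda>w. f w $ i $ k) analytic_on {a}"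
proof -
  obtain S where S: "open S" "a \<in> S" "\<And>w. w \<in> S \<Longrightarrow> matrix_derivative_at f (D w) w"
    using assms unfolding eventually_nhds by blast
  then have "(\<lambda>w. f w $ i $ k) holomorphic_on S"
    unfolding holomorphic_on_open [OF S(1)] matrix_derivative_at_def by blast
  then show ?thesis
    using S unfolding analytic_at by blast
qed

lemma eventually_analytic_at:
  assumes "f analytic_on {a}"
  shows "\<forall>\<^sub>F w in nhds a. f analytic_on {w}"
  using assms unfolding analytic_at eventually_nhds by blast

lemma matrix_derivative_at_cong:
  assumes "\<forall>\<^sub>F v in nhds w. f v = g v"
  shows "matrix_derivative_at f D w \<longleftrightarrow> matrix_derivative_at g D w"
  unfolding matrix_derivative_at_def
proof (intro arg_cong [where f = All] ext DERIV_cong_ev refl)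
  show "\<forall>\<^sub>F v in nhds w. f v $ i $ k = g v $ i $ k" for i k
    using assms by eventually_elim simp
qed

lemma matrix_derivative_at_inversion:
  fixes f :: "complex \<Rightarrow> complex ^ 'k ^ 'm" and D D' :: "complex ^ 'k ^ 'm"
  assumes "w \<noteq> 0" and D: "\<And>i k. D' $ i $ k = - D $ i $ k / w\<^sup>2"
  shows "matrix_derivative_at (\<lambda>v. f (1 / v)) D' w \<longleftrightarrow> matrix_derivative_at f D (1 / w)"
proof -
  have chain: "((\<lambda>v. g (1 / v)) has_field_derivative - d / w\<^sup>2) (at w)"
    if "(g has_field_derivative d) (at (1 / w))" "w \<noteq> 0" for g :: "complex \<Rightarrow> complex" and d w
  proof -
    have "((\<lambda>v. 1 / v) has_field_derivative - 1 / w\<^sup>2) (at w)"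
      using that(2) by (auto intro!: derivative_eq_intros simp: power2_eq_square)
    from DERIV_chain2 [OF that(1) this] show ?thesis
      by simp
  qed
  have iff: "((\<lambda>v. g (1 / v)) has_field_derivative - d / w\<^sup>2) (at w) \<longleftrightarrow>
      (g has_field_derivative d) (at (1 / w))" for g d
  proof
    assume "((\<lambda>v. g (1 / v)) has_field_derivative - d / w\<^sup>2) (at w)"
    \<comment> \<open>Inversion is an involution, so the converse is the chain rule again, at the
      point \<open>1 / w\<close>.\<close>
    then have "((\<lambda>v. g (1 / (1 / v))) has_field_derivative - (- d / w\<^sup>2) / (1 / w)\<^sup>2) (at (1 / w))"
      using assms(1) by (intro chain [of "\<lambda>v. g (1 / v)"]) auto
    then show "(g has_field_derivative d) (at (1 / w))"
      using assms(1) by (simp add: field_simps)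
  qed (rule chain [OF _ assms(1)])
  show ?thesis
    unfolding matrix_derivative_at_def D
    using iff [of "\<lambda>x. f x $ i $ k" "D $ i $ k" for i k] by simp
qed

section \<open>The local system of solutions of a Fuchsian equation\<close>

lemma open_punctured_sphere: "open (punctured_sphere t)"
proof -
  have "Fin -` punctured_sphere t = - range (\<lambda>p. t $ p)"
    by (auto simp: punctured_sphere_def)
  then show ?thesis
    by (simp add: open_riemann_sphere_def open_Compl finite_imp_closed finite_imp_compact)
qed

locale fuchsian_system =
  fixes Q :: "'n::finite \<Rightarrow> complex ^ 'n \<Rightarrow> 'k::finite cmatrix" and t :: "complex ^ 'n"
  assumes sum_residues: "(\<Sum>p\<in>UNIV. Q p t) = 0"
begin

text \<open>At infinity put \<open>x = 1 / w\<close>: the coefficient becomes minus the sum of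
  \<open>Q_p / (w (1 - w t_p))\<close>, and
  \<open>1 / (w (1 - w t_p)) = 1 / w + t_p / (1 - w t_p)\<close>. The parts with
  \<open>1 / w\<close> cancel because the residues add up to zero, which leaves a coefficient
  regular at \<open>w = 0\<close>.\<close>

definition chart_coeff :: "riemann_sphere \<Rightarrow> complex \<Rightarrow> 'k cmatrix" where
  "chart_coeff z w =
     (case z of Fin a \<Rightarrow> fuchsian_coeff Q t (a + w)
      | Infty \<Rightarrow> (\<chi> i k. - (\<Sum>p\<in>UNIV. Q p t $ i $ k * t $ p / (1 - w * t $ p))))"

text \<open>The equation at the single point \<open>z\<close>, written in the chart centred at \<open>z\<close>; at infinity this
  uses that the residues add up to zero.\<close>

definition solves_at :: "(riemann_sphere \<Rightarrow> 'k cmatrix) \<Rightarrow> riemann_sphere \<Rightarrow> bool" where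
  "solves_at F z \<longleftrightarrow>
     matrix_derivative_at (\<lambda>w. F (sphere_chart z w)) (chart_coeff z 0 ** F z) 0"

definition solution_germ :: "(riemann_sphere \<Rightarrow> 'k cmatrix) \<Rightarrow> riemann_sphere \<Rightarrow> bool" where
  "solution_germ F z \<longleftrightarrow> (\<forall>\<^sub>F y in nhds z. solves_at F y)"

lemma chart_coeff_analytic:
  assumes "z \<in> punctured_sphere t"
  shows "(\<lambda>w. chart_coeff z w $ i $ k) analytic_on {0}"
  using assms
  by (cases z) (auto simp: chart_coeff_def fuchsian_coeff_def punctured_sphere_def
      intro!: analytic_intros)

lemma chart_coeff_Infty:
  assumes w: "w \<noteq> 0" "\<And>p. 1 - w * t $ p \<noteq> 0"
  shows "chart_coeff Infty w $ i $ k = - fuchsian_coeff Q t (1 / w) $ i $ k / w\<^sup>2"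
proof -
  have "(\<Sum>p\<in>UNIV. Q p t $ i $ k) = 0"
    using arg_cong [OF sum_residues, of "\<lambda>A. A $ i $ k"] by simp
  then have "w * (\<Sum>p\<in>UNIV. Q p t $ i $ k * t $ p / (1 - w * t $ p)) =
      (\<Sum>p\<in>UNIV. Q p t $ i $ k + w * (Q p t $ i $ k * t $ p / (1 - w * t $ p)))"
    by (simp add: sum.distrib sum_distrib_left)
  also have "\<dots> = (\<Sum>p\<in>UNIV. Q p t $ i $ k / (1 / w - t $ p) / w)"
  proof (rule sum.cong)
    fix p
    have "1 / w - t $ p \<noteq> 0"
      using w by (auto simp: field_simps)
    then show "Q p t $ i $ k + w * (Q p t $ i $ k * t $ p / (1 - w * t $ p)) =
        Q p t $ i $ k / (1 / w - t $ p) / w"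
      using w by (simp add: divide_simps) (simp add: algebra_simps)
  qed simp
  also have "\<dots> = fuchsian_coeff Q t (1 / w) $ i $ k / w"
    by (simp add: fuchsian_coeff_def sum_divide_distrib)
  finally show ?thesis
    using w(1) by (simp add: chart_coeff_def field_simps power2_eq_square)
qed

lemma solves_at_Fin:
  "solves_at F (Fin x) \<longleftrightarrow>
     matrix_derivative_at (\<lambda>x. F (Fin x)) (fuchsian_coeff Q t x ** F (Fin x)) x"
  using DERIV_shift [where z = x and x = 0]
  by (simp add: solves_at_def matrix_derivative_at_def chart_coeff_def add.commute [of x])

text \<open>\<open>solves_at\<close> uses the chart centred at the point concerned; here it is
  compared with one fixed chart. The quantifier over \<open>F\<close> stands inside, so the
  neighbourhood does not depend on \<open>F\<close>.\<close>

lemma eventually_solves_at_chart: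
  "\<forall>\<^sub>F w in nhds 0. \<forall>F. solves_at F (sphere_chart z w) \<longleftrightarrow>
     matrix_derivative_at (\<lambda>v. F (sphere_chart z v)) (chart_coeff z w ** F (sphere_chart z w)) w"
proof (cases z)
  case (Fin a)
  show ?thesis
    using DERIV_shift [where z = a]
    by (intro always_eventually allI)
      (simp add: Fin solves_at_Fin matrix_derivative_at_def chart_coeff_def add.commute [of a])
next
  case Infty
  have "\<forall>\<^sub>F w in nhds 0. \<forall>p. 1 - w * t $ p \<noteq> 0"
  proof (intro eventually_all_finite)
    fix p
    show "\<forall>\<^sub>F w in nhds 0. 1 - w * t $ p \<noteq> 0"
      using eventually_nhds_in_open [of "{w. 1 - w * t $ p \<noteq> 0}" 0]
      by (simp add: open_Collect_neq continuous_intros)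
  qed
  then show ?thesis
  proof (eventually_elim, intro allI)
    fix w and F :: "riemann_sphere \<Rightarrow> 'k cmatrix"
    assume p: "\<forall>p. 1 - w * t $ p \<noteq> 0"
    show "solves_at F (sphere_chart z w) \<longleftrightarrow>
      matrix_derivative_at (\<lambda>v. F (sphere_chart z v)) (chart_coeff z w ** F (sphere_chart z w)) w"
    proof (cases "w = 0")
      case True
      then show ?thesis
        by (simp add: Infty solves_at_def chart_at_Infty_def)
    next
      case False
      have "\<forall>\<^sub>F v in nhds w. v \<noteq> 0"
        using False by (rule t1_space_nhds)
      then have "\<forall>\<^sub>F v in nhds w. F (sphere_chart z v) = F (Fin (1 / v))"
        by eventually_elim (simp add: Infty chart_at_Infty_def)
      then have "matrix_derivative_at (\<lambda>v. F (sphere_chart z v)) (chart_coeff z w ** F (sphere_chart z w)) w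
         \<longleftrightarrow> matrix_derivative_at (\<lambda>v. F (Fin (1 / v))) (chart_coeff z w ** F (sphere_chart z w)) w"
        by (rule matrix_derivative_at_cong)
      also have "\<dots> \<longleftrightarrow> matrix_derivative_at (\<lambda>x. F (Fin x))
          (fuchsian_coeff Q t (1 / w) ** F (Fin (1 / w))) (1 / w)"
        using False p
        by (intro matrix_derivative_at_inversion [where f = "\<lambda>x. F (Fin x)"])
          (auto simp: Infty chart_at_Infty_def matrix_mult_nth chart_coeff_Infty sum_negf sum_divide_distrib)
      finally show ?thesis
        using False by (simp add: Infty chart_at_Infty_def solves_at_Fin)
    qed
  qed
qed

lemma solution_germ_chart:
  "solution_germ F z \<longleftrightarrow> (\<forall>\<^sub>F w in nhds 0.
     matrix_derivative_at (\<lambda>v. F (sphere_chart z v)) (chart_coeff z w ** F (sphere_chart z w)) w)"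
proof -
  have "solution_germ F z \<longleftrightarrow> (\<forall>\<^sub>F w in nhds 0. solves_at F (sphere_chart z w))"
    unfolding solution_germ_def by (rule eventually_nhds_sphere_chart)
  also have "\<dots> \<longleftrightarrow> (\<forall>\<^sub>F w in nhds 0.
     matrix_derivative_at (\<lambda>v. F (sphere_chart z v)) (chart_coeff z w ** F (sphere_chart z w)) w)"
    by (rule eventually_subst) (use eventually_solves_at_chart [of z] in \<open>auto elim: eventually_mono\<close>)
  finally show ?thesis .
qed

lemma solution_germ_eventually:
  "solution_germ F z \<Longrightarrow> \<forall>\<^sub>F y in nhds z. solution_germ F y"
  unfolding solution_germ_def by (simp add: eventually_eventually)

lemma solves_at_cong:
  assumes "\<forall>\<^sub>F y in nhds z. F y = G y"
  shows "solves_at F z \<longleftrightarrow> solves_at G z"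
proof -
  have "F z = G z"
    using assms by (rule eventually_nhds_x_imp_x)
  moreover have "\<forall>\<^sub>F w in nhds 0. F (sphere_chart z w) = G (sphere_chart z w)"
    using assms by (simp only: eventually_nhds_sphere_chart [of _ z])
  ultimately show ?thesis
    unfolding solves_at_def by (simp add: matrix_derivative_at_cong)
qed

lemma solution_germ_cong:
  assumes "\<forall>\<^sub>F y in nhds z. F y = G y"
  shows "solution_germ F z \<longleftrightarrow> solution_germ G z"
  unfolding solution_germ_def
proof (rule eventually_subst)
  show "\<forall>\<^sub>F y in nhds z. solves_at F y = solves_at G y"
    using eventually_eventually [THEN iffD2, OF assms]
    by (rule eventually_mono) (rule solves_at_cong)
qed

lemma solution_germ_analytic:
  assumes "solution_germ F z"
  shows "sphere_analytic_at F z"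
  unfolding sphere_analytic_at_chart
  by (intro allI matrix_derivative_at_imp_analytic [OF assms [unfolded solution_germ_chart]])

lemma solution_germ_mult:
  assumes "solution_germ F z"
  shows "solution_germ (\<lambda>y. F y ** C) z"
  using assms unfolding solution_germ_def
proof eventually_elim
  case (elim y)
  show ?case
    unfolding solves_at_def matrix_derivative_at_def
  proof (intro allI)
    fix i k
    have "((\<lambda>w. \<Sum>l\<in>UNIV. F (sphere_chart y w) $ i $ l * C $ l $ k) has_field_derivative
        (\<Sum>l\<in>UNIV. (chart_coeff y 0 ** F y) $ i $ l * C $ l $ k)) (at 0)"
      using elim unfolding solves_at_def matrix_derivative_at_def
      by (intro DERIV_sum DERIV_cmult_right) auto
    then show "((\<lambda>w. (F (sphere_chart y w) ** C) $ i $ k) has_field_derivative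
        (chart_coeff y 0 ** (F y ** C)) $ i $ k) (at 0)"
      by (simp add: matrix_mul_assoc) (simp add: matrix_mult_nth)
  qed
qed

lemma fundamental_germ:
  assumes z: "z \<in> punctured_sphere t"
  obtains P where "P z = mat 1" "solution_germ P z" "\<forall>\<^sub>F y in nhds z. invertible (P y)"
    "\<And>F. solution_germ F z \<Longrightarrow> \<forall>\<^sub>F y in nhds z. F y = P y ** F z"
proof -
  obtain p where p: "p 0 = mat 1" "\<forall>\<^sub>F w in nhds 0. matrix_derivative_at p (chart_coeff z w ** p w) w"
    "\<forall>\<^sub>F w in nhds 0. invertible (p w)"
    and uniq: "\<And>f :: complex \<Rightarrow> 'k cmatrix. \<forall>\<^sub>F w in nhds 0. matrix_derivative_at f (chart_coeff z w ** f w) w \<Longrightarrow>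
       \<forall>\<^sub>F w in nhds 0. f w = p w ** f 0"
    using chart_coeff_analytic [OF z] by (rule linear_ode_fundamental_solution) auto
  \<comment> \<open>Off the range of the chart the values of \<open>inv\<close> are arbitrary, which
    is harmless since all claims concern neighbourhoods of \<open>z\<close>.\<close>
  define P where "P y = p (inv (sphere_chart z) y)" for y
  have P: "P (sphere_chart z w) = p w" for w
    by (simp add: P_def inj_sphere_chart)
  show thesis
  proof (rule that [of P])
    show "P z = mat 1"
      using P [of 0] p(1) by simp
    show "solution_germ P z"
      using p(2) by (simp add: solution_germ_chart P)
    show "\<forall>\<^sub>F y in nhds z. invertible (P y)"
      using p(3) by (subst eventually_nhds_sphere_chart) (simp add: P)
    show "\<forall>\<^sub>F y in nhds z. F y = P y ** F z" if "solution_germ F z" for F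
      using uniq [of "\<lambda>w. F (sphere_chart z w)"] that
      by (subst eventually_nhds_sphere_chart) (simp add: P solution_germ_chart)
  qed
qed

lemma solution_germ_unique:
  assumes "z \<in> punctured_sphere t" "solution_germ F z" "solution_germ G z" "F z = G z"
  shows "\<forall>\<^sub>F y in nhds z. F y = G y"
proof -
  obtain P where P: "\<And>F. solution_germ F z \<Longrightarrow> \<forall>\<^sub>F y in nhds z. F y = P y ** F z"
    using assms(1) by (rule fundamental_germ) blast
  show ?thesis
    using P [OF assms(2)] P [OF assms(3)] by eventually_elim (simp add: assms(4))
qed

section \<open>Permanence of the equation under analytic continuation\<close>

text \<open>On a disc in the chart both sides of the equation are holomorphic, so if they agree near
  one point of the disc, they agree on all of it. This serves twice: continuations are only asked to
  consist of analytic germs, and at infinity a normalized solution is described by the equation at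
  finite points.\<close>

lemma analytic_germ_is_solution:
  assumes z: "z \<in> punctured_sphere t" and F: "sphere_analytic_at F z"
  shows "\<forall>\<^sub>F y in nhds z. solution_germ F y \<longrightarrow> solution_germ F z"
proof -
  define f where "f w = F (sphere_chart z w)" for w
  have "\<forall>\<^sub>F w in nhds 0. \<forall>i k. (\<lambda>w. f w $ i $ k) analytic_on {w}"
    using F unfolding sphere_analytic_at_chart f_def
    by (intro eventually_all_finite eventually_analytic_at) blast
  moreover have "\<forall>\<^sub>F w in nhds 0. \<forall>i k. (\<lambda>w. chart_coeff z w $ i $ k) analytic_on {w}"
    using chart_coeff_analytic [OF z] by (intro eventually_all_finite eventually_analytic_at)
  ultimately have "\<forall>\<^sub>F w in nhds 0.
      (\<forall>i k. (\<lambda>w. f w $ i $ k) analytic_on {w}) \<and>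
      (\<forall>i k. (\<lambda>w. chart_coeff z w $ i $ k) analytic_on {w}) \<and>
      (solves_at F (sphere_chart z w) \<longleftrightarrow> matrix_derivative_at f (chart_coeff z w ** f w) w)"
    using eventually_solves_at_chart [of z]
    by eventually_elim (simp add: f_def [abs_def])
  then obtain r where r: "r > 0"
    and an_f: "\<And>w i k. w \<in> ball 0 r \<Longrightarrow> (\<lambda>w. f w $ i $ k) analytic_on {w}"
    and an_B: "\<And>w i k. w \<in> ball 0 r \<Longrightarrow> (\<lambda>w. chart_coeff z w $ i $ k) analytic_on {w}"
    and sol: "\<And>w. w \<in> ball 0 r \<Longrightarrow>
      solves_at F (sphere_chart z w) \<longleftrightarrow> matrix_derivative_at f (chart_coeff z w ** f w) w"
    unfolding eventually_nhds_metric by (auto simp: dist_commute)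
  have hol_f: "(\<lambda>w. f w $ i $ k) holomorphic_on ball 0 r"
    and hol_B: "(\<lambda>w. chart_coeff z w $ i $ k) holomorphic_on ball 0 r" for i k
    using an_f an_B by (meson analytic_imp_holomorphic analytic_on_analytic_at)+
  have near: "solution_germ F z" if w: "w \<in> ball 0 r" and sw: "solution_germ F (sphere_chart z w)" for w
  proof -
    have "\<forall>\<^sub>F v in nhds w. v \<in> ball 0 r \<and> solves_at F (sphere_chart z v)"
      using sw w unfolding solution_germ_def
      by (intro eventually_conj eventually_nhds_in_open eventually_sphere_chart_at) auto
    then obtain S where S: "open S" "w \<in> S" "S \<subseteq> ball 0 r"
      and dS: "\<And>v. v \<in> S \<Longrightarrow> matrix_derivative_at f (chart_coeff z v ** f v) v"
      unfolding eventually_nhds using sol by (metis subsetI)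
    have "deriv (\<lambda>w. f w $ i $ k) v = (chart_coeff z v ** f v) $ i $ k" if "v \<in> ball 0 r" for i k v
    proof (rule analytic_continuation_open [where s = S and s' = "ball 0 r"
          and f = "deriv (\<lambda>w. f w $ i $ k)" and g = "\<lambda>v. (chart_coeff z v ** f v) $ i $ k"])
      show "deriv (\<lambda>w. f w $ i $ k) holomorphic_on ball 0 r"
        by (intro holomorphic_deriv hol_f) auto
      show "(\<lambda>v. (chart_coeff z v ** f v) $ i $ k) holomorphic_on ball 0 r"
        unfolding matrix_mult_nth by (intro holomorphic_intros hol_f hol_B)
      show "deriv (\<lambda>w. f w $ i $ k) v = (chart_coeff z v ** f v) $ i $ k" if "v \<in> S" for v
        using dS [OF that] unfolding matrix_derivative_at_def by (auto intro: DERIV_imp_deriv)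
    qed (use S that in auto)
    then have "matrix_derivative_at f (chart_coeff z v ** f v) v" if "v \<in> ball 0 r" for v
      unfolding matrix_derivative_at_def
      using that by (metis hol_f holomorphic_derivI open_ball)
    then show ?thesis
      unfolding solution_germ_chart f_def [symmetric]
      using eventually_nhds_in_open [of "ball 0 r" 0] r by (auto elim: eventually_mono)
  qed
  have "\<forall>\<^sub>F w in nhds 0. w \<in> ball 0 r"
    using r by (intro eventually_nhds_in_open) auto
  then show ?thesis
    unfolding eventually_nhds_sphere_chart [of _ z] by eventually_elim (auto intro: near)
qed

lemma solution_germ_iff_nearby:
  assumes "z \<in> punctured_sphere t" "sphere_analytic_at F z"
  shows "\<forall>\<^sub>F y in nhds z. solution_germ F y \<longleftrightarrow> solution_germ F z"
proof (cases "solution_germ F z")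
  case True
  then show ?thesis
    using solution_germ_eventually by simp
next
  case False
  then show ?thesis
    using analytic_germ_is_solution [OF assms] by simp
qed

lemma normalized_local_solution_iff:
  assumes x0: "x0 \<in> punctured_sphere t"
  shows "normalized_local_solution Q x0 t Y \<longleftrightarrow> solution_germ Y x0 \<and> Y x0 = mat 1"
proof -
  have ode: "(\<forall>x. z = Fin x \<longrightarrow> (\<forall>i k. ((\<lambda>u. Y (Fin u) $ i $ k) has_field_derivative
      (fuchsian_coeff Q t x ** Y (Fin x)) $ i $ k) (at x))) \<longleftrightarrow> z = Infty \<or> solves_at Y z" for z
    by (cases z) (auto simp: solves_at_Fin matrix_derivative_at_def)
  have "solution_germ Y x0"
    if an: "sphere_analytic_at Y x0" and ev: "\<forall>\<^sub>F z in nhds x0. z = Infty \<or> solves_at Y z"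
  proof (cases x0)
    case (Fin a)
    then show ?thesis
      using ev by (simp add: solution_germ_def eventually_nhds_Fin)
  next
    case Infty
    \<comment> \<open>The equation is not imposed at infinity itself, but nearby finite points carry
      solution germs, and permanence takes this back to infinity.\<close>
    have "\<forall>\<^sub>F y in nhds x0. y \<noteq> Infty \<longrightarrow> solution_germ Y y"
      using eventually_eventually [THEN iffD2, OF ev]
    proof eventually_elim
      case (elim y)
      then show ?case
        by (cases y) (simp_all add: solution_germ_def eventually_nhds_Fin)
    qed
    with analytic_germ_is_solution [OF x0 an]
    have "\<forall>\<^sub>F y in nhds x0. y \<noteq> Infty \<longrightarrow> solution_germ Y x0"
      by eventually_elim blast
    then have "\<forall>\<^sub>F w in nhds (0::complex). w \<noteq> 0 \<longrightarrow> solution_germ Y x0"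
      unfolding Infty eventually_nhds_Infty by eventually_elim (simp add: chart_at_Infty_def)
    \<comment> \<open>The punctured neighbourhood filter of 0 is nontrivial, so the constant
      statement follows.\<close>
    then have "\<forall>\<^sub>F w in at (0::complex). solution_germ Y x0"
      by (simp add: eventually_at_filter)
    then show ?thesis by simp
  qed
  then show ?thesis
    unfolding normalized_local_solution_def ode
    using solution_germ_analytic by (auto simp: solution_germ_def elim: eventually_mono)
qed

section \<open>Analytic continuation as parallel transport\<close>

definition solution_frame :: "riemann_sphere set \<Rightarrow> (riemann_sphere \<Rightarrow> 'k cmatrix) \<Rightarrow> bool" where
  "solution_frame U \<Phi> \<longleftrightarrow> open U \<and> U \<subseteq> punctured_sphere t \<and>
     (\<forall>z\<in>U. invertible (\<Phi> z) \<and> solution_germ \<Phi> z)"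

lemma solution_germ_in_frame:
  assumes U: "solution_frame U \<Phi>" "z \<in> U" and F: "solution_germ F z"
  shows "\<exists>C. \<forall>\<^sub>F y in nhds z. F y = \<Phi> y ** C"
proof -
  have z: "z \<in> punctured_sphere t" and \<Phi>: "invertible (\<Phi> z)" "solution_germ \<Phi> z"
    using U by (auto simp: solution_frame_def)
  obtain N where N: "\<Phi> z ** N = mat 1"
    using \<Phi>(1) unfolding invertible_def by blast
  have "\<forall>\<^sub>F y in nhds z. F y = \<Phi> y ** (N ** F z)"
    using z F solution_germ_mult [OF \<Phi>(2)]
    by (intro solution_germ_unique) (auto simp: matrix_mul_assoc [of "\<Phi> z"] N)
  then show ?thesis ..
qed

lemma solution_frame_exists:
  assumes z: "z \<in> punctured_sphere t"
  shows "\<exists>U \<Phi>. solution_frame U \<Phi> \<and> z \<in> U"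
proof -
  obtain P where P: "solution_germ P z" "\<forall>\<^sub>F y in nhds z. invertible (P y)"
    using z by (rule fundamental_germ)
  have "\<forall>\<^sub>F y in nhds z. y \<in> punctured_sphere t \<and> invertible (P y) \<and> solution_germ P y"
    using z P by (intro eventually_conj eventually_nhds_in_open solution_germ_eventually)
      (auto simp: open_punctured_sphere)
  then show ?thesis
    unfolding eventually_nhds solution_frame_def by (metis subsetI)
qed

sublocale local_system "punctured_sphere t" solution_frame
proof
  show "open U" if "solution_frame U \<Phi>" for U \<Phi>
    using that by (simp add: solution_frame_def)
  show "invertible (\<Phi> z)" if "solution_frame U \<Phi>" "z \<in> U" for U \<Phi> z
    using that by (simp add: solution_frame_def)
  show "\<exists>U \<Phi>. solution_frame U \<Phi> \<and> z \<in> U" if "z \<in> punctured_sphere t" for z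
    using that by (rule solution_frame_exists)
  show "\<exists>C. \<forall>\<^sub>F y in nhds z. \<Psi> y = \<Phi> y ** C"
    if "solution_frame U \<Phi>" "solution_frame V \<Psi>" "z \<in> U" "z \<in> V" for U V \<Phi> \<Psi> z
    using that by (intro solution_germ_in_frame) (auto simp: solution_frame_def)
qed

text \<open>Being a solution germ is preserved along the path: it is unaffected by moving a fixed
  analytic germ to a nearby point and by passing to an agreeing germ. Once every germ is a solution,
  it is a constant multiple of a frame, and nearby values share this constant.\<close>

lemma continuation_parallel:
  assumes \<gamma>: "path \<gamma>" "path_image \<gamma> \<subseteq> punctured_sphere t"
    and cont: "analytic_continuation_along \<gamma> \<Psi>" and sol: "solution_germ (\<Psi> 0) (\<gamma> 0)"
  shows "parallel_on {0..1} \<gamma> (\<lambda>s. \<Psi> s (\<gamma> s))"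
proof -
  have S: "\<gamma> s \<in> punctured_sphere t" if "s \<in> {0..1}" for s
    using that \<gamma>(2) by (auto simp: path_image_def)
  have an: "sphere_analytic_at (\<Psi> s) (\<gamma> s)" if "s \<in> {0..1}" for s
    using cont that by (simp add: analytic_continuation_along_def)
  have agree: "\<forall>\<^sub>F s' in nhds s. s' \<in> {0..1} \<longrightarrow> (\<forall>\<^sub>F z in nhds (\<gamma> s'). \<Psi> s' z = \<Psi> s z)"
    if "s \<in> {0..1}" for s
  proof -
    have "\<forall>\<^sub>F s' in at s within {0..1}. \<forall>\<^sub>F z in nhds (\<gamma> s'). \<Psi> s' z = \<Psi> s z"
      using cont that by (simp add: analytic_continuation_along_def)
    then show ?thesis
      unfolding eventually_at_filter by (rule eventually_mono) auto
  qed
  have cont\<gamma>: "continuous_on {0..1} \<gamma>"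
    using \<gamma>(1) by (simp add: path_def)
  have germ: "solution_germ (\<Psi> s) (\<gamma> s)" if s: "s \<in> {0..1}" for s
  proof -
    have "solution_germ (\<Psi> 0) (\<gamma> 0) = solution_germ (\<Psi> s) (\<gamma> s)"
    proof (rule connected_local_const [of "{0..1}"], safe)
      fix s :: real assume s: "s \<in> {0..1}"
      have "\<forall>\<^sub>F s' in nhds s. s' \<in> {0..1} \<longrightarrow>
          (solution_germ (\<Psi> s) (\<gamma> s') \<longleftrightarrow> solution_germ (\<Psi> s) (\<gamma> s))"
        by (rule eventually_nhds_continuous_on [OF cont\<gamma> s solution_germ_iff_nearby [OF S an]])
          (use s in auto)
      with agree [OF s] have "\<forall>\<^sub>F s' in nhds s. s' \<in> {0..1} \<longrightarrow>
          (solution_germ (\<Psi> s) (\<gamma> s) = solution_germ (\<Psi> s') (\<gamma> s'))"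
        by eventually_elim (auto dest: solution_germ_cong)
      then show "\<forall>\<^sub>F s' in at s within {0..1}.
          solution_germ (\<Psi> s) (\<gamma> s) = solution_germ (\<Psi> s') (\<gamma> s')"
        by (auto simp: eventually_at_filter elim: eventually_mono)
    qed (use s in auto)
    with sol show ?thesis by simp
  qed
  show ?thesis
    unfolding parallel_on_def
  proof
    fix s :: real assume s: "s \<in> {0..1}"
    obtain U \<Phi> where U: "solution_frame U \<Phi>" "\<gamma> s \<in> U"
      using solution_frame_exists [OF S [OF s]] by blast
    obtain C where "\<forall>\<^sub>F y in nhds (\<gamma> s). \<Psi> s y = \<Phi> y ** C"
      using solution_germ_in_frame [OF U germ [OF s]] by blast
    then have "\<forall>\<^sub>F s' in nhds s. s' \<in> {0..1} \<longrightarrow> \<Psi> s (\<gamma> s') = \<Phi> (\<gamma> s') ** C"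
      by (rule eventually_nhds_continuous_on [OF cont\<gamma> s])
    with agree [OF s] have "\<forall>\<^sub>F s' in nhds s. s' \<in> {0..1} \<longrightarrow> \<Psi> s' (\<gamma> s') = \<Phi> (\<gamma> s') ** C"
      by eventually_elim (auto dest: eventually_nhds_x_imp_x)
    with U show "\<exists>U \<Phi> C. solution_frame U \<Phi> \<and> \<gamma> s \<in> U \<and>
        (\<forall>\<^sub>F s' in nhds s. s' \<in> {0..1} \<longrightarrow> \<Psi> s' (\<gamma> s') = \<Phi> (\<gamma> s') ** C)"
      by blast
  qed
qed

text \<open>At each parameter a local solution through the section is chosen. Neighbouring choices
  are solutions with the same value at a common point of the path, so they coincide as
  germs.\<close>

lemma parallel_continuation:
  assumes \<gamma>: "path \<gamma>" "path_image \<gamma> \<subseteq> punctured_sphere t" and g: "parallel_on {0..1} \<gamma> g"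
  obtains \<Psi> where "analytic_continuation_along \<gamma> \<Psi>" "solution_germ (\<Psi> 0) (\<gamma> 0)"
    "\<Psi> 0 (\<gamma> 0) = g 0" "\<Psi> 1 (\<gamma> 1) = g 1"
proof -
  have "\<forall>s\<in>{0..1}. \<exists>F U. open U \<and> \<gamma> s \<in> U \<and> U \<subseteq> punctured_sphere t \<and> (\<forall>z\<in>U. solution_germ F z) \<and>
      (\<forall>\<^sub>F s' in nhds s. s' \<in> {0..1} \<longrightarrow> g s' = F (\<gamma> s'))"
  proof
    fix s :: real assume "s \<in> {0..1}"
    with g obtain U \<Phi> C where U: "solution_frame U \<Phi>" "\<gamma> s \<in> U"
      "\<forall>\<^sub>F q in nhds s. q \<in> {0..1} \<longrightarrow> g q = \<Phi> (\<gamma> q) ** C"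
      by (rule parallel_onE)
    then show "\<exists>F U. open U \<and> \<gamma> s \<in> U \<and> U \<subseteq> punctured_sphere t \<and> (\<forall>z\<in>U. solution_germ F z) \<and>
      (\<forall>\<^sub>F s' in nhds s. s' \<in> {0..1} \<longrightarrow> g s' = F (\<gamma> s'))"
      by (intro exI [of _ "\<lambda>z. \<Phi> z ** C"] exI [of _ U])
        (auto simp: solution_frame_def intro: solution_germ_mult)
  qed
  from bchoice [OF this] obtain \<Psi> where
    \<Psi>: "\<forall>s\<in>{0..1}. \<exists>U. open U \<and> \<gamma> s \<in> U \<and> U \<subseteq> punctured_sphere t \<and> (\<forall>z\<in>U. solution_germ (\<Psi> s) z) \<and>
      (\<forall>\<^sub>F s' in nhds s. s' \<in> {0..1} \<longrightarrow> g s' = \<Psi> s (\<gamma> s'))" ..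
  from bchoice [OF \<Psi>] obtain U where
    U: "\<And>s. s \<in> {0..1} \<Longrightarrow> open (U s) \<and> \<gamma> s \<in> U s \<and> U s \<subseteq> punctured_sphere t \<and> (\<forall>z\<in>U s. solution_germ (\<Psi> s) z)"
    and ev: "\<And>s. s \<in> {0..1} \<Longrightarrow> \<forall>\<^sub>F s' in nhds s. s' \<in> {0..1} \<longrightarrow> g s' = \<Psi> s (\<gamma> s')"
    by blast
  have at: "\<Psi> s (\<gamma> s) = g s" "solution_germ (\<Psi> s) (\<gamma> s)" if "s \<in> {0..1}" for s
    using eventually_nhds_x_imp_x [OF ev [OF that]] U that by auto
  have cont\<gamma>: "continuous_on {0..1} \<gamma>"
    using \<gamma>(1) by (simp add: path_def)
  have "analytic_continuation_along \<gamma> \<Psi>"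
    unfolding analytic_continuation_along_def
  proof (intro ballI conjI)
    fix s :: real assume s: "s \<in> {0..1}"
    show "sphere_analytic_at (\<Psi> s) (\<gamma> s)"
      using at(2) [OF s] by (rule solution_germ_analytic)
    have "\<forall>\<^sub>F s' in nhds s. s' \<in> {0..1} \<longrightarrow> \<gamma> s' \<in> U s"
      using U [OF s] by (intro eventually_nhds_continuous_on [OF cont\<gamma> s] eventually_nhds_in_open) auto
    with ev [OF s] have "\<forall>\<^sub>F s' in nhds s. s' \<in> {0..1} \<longrightarrow> (\<forall>\<^sub>F z in nhds (\<gamma> s'). \<Psi> s' z = \<Psi> s z)"
    proof eventually_elim
      case (elim s')
      then show ?case
        using U [OF s] at [of s'] by (auto intro!: solution_germ_unique)
    qed
    then show "\<forall>\<^sub>F s' in at s within {0..1}. \<forall>\<^sub>F z in nhds (\<gamma> s'). \<Psi> s' z = \<Psi> s z"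
      by (auto simp: eventually_at_filter elim: eventually_mono)
  qed
  then show thesis
    using at by (intro that [of \<Psi>]) auto
qed

text \<open>This evaluates the definite description: a parallel section yields a continuation, and
  any other continuation is a parallel section with the same initial value.\<close>

lemma continued_solution_eq:
  assumes \<gamma>: "path \<gamma>" "path_image \<gamma> \<subseteq> punctured_sphere t" "pathstart \<gamma> = x0"
    and g: "parallel_on {0..1} \<gamma> g" "g 0 = mat 1"
  shows "continued_solution Q x0 t \<gamma> = g 1"
  unfolding continued_solution_def
proof (rule the_equality)
  have x0: "x0 \<in> punctured_sphere t" "\<gamma> 0 = x0"
    using \<gamma>(2,3) pathstart_in_path_image by (auto simp: pathstart_def)
  note norm_iff = normalized_local_solution_iff [OF x0(1)]
  obtain \<Psi> where "analytic_continuation_along \<gamma> \<Psi>" "solution_germ (\<Psi> 0) (\<gamma> 0)"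
    "\<Psi> 0 (\<gamma> 0) = g 0" "\<Psi> 1 (\<gamma> 1) = g 1"
    using \<gamma>(1,2) g(1) by (rule parallel_continuation)
  then show "\<exists>\<Psi>. analytic_continuation_along \<gamma> \<Psi> \<and> normalized_local_solution Q x0 t (\<Psi> 0) \<and>
      g 1 = \<Psi> 1 (pathfinish \<gamma>)"
    unfolding norm_iff using x0(2) g(2) by (auto simp: pathfinish_def)
  fix M
  assume "\<exists>\<Psi>. analytic_continuation_along \<gamma> \<Psi> \<and> normalized_local_solution Q x0 t (\<Psi> 0) \<and>
      M = \<Psi> 1 (pathfinish \<gamma>)"
  then obtain \<Psi> where \<Psi>: "analytic_continuation_along \<gamma> \<Psi>" "solution_germ (\<Psi> 0) x0" "\<Psi> 0 x0 = mat 1"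
    "M = \<Psi> 1 (\<gamma> 1)"
    unfolding norm_iff by (auto simp: pathfinish_def)
  have "parallel_on {0..1} \<gamma> (\<lambda>s. \<Psi> s (\<gamma> s))"
    using \<gamma> \<Psi> x0(2) by (intro continuation_parallel) auto
  then have "\<Psi> 1 (\<gamma> 1) = g 1"
    using \<gamma>(1) g \<Psi>(3) x0(2)
    by (intro parallel_on_unique [of "{0..1}" \<gamma> "\<lambda>s. \<Psi> s (\<gamma> s)" g 0 1]) (auto simp: path_def)
  then show "M = g 1"
    using \<Psi>(4) by simp
qed

end

lemma joinpaths_at: "(p +++ q) 0 = p 0" "(p +++ q) 1 = q 1"
  by (simp_all add: joinpaths_def)

lemma loop_in_const: "x \<in> S \<Longrightarrow> loop_in S x (\<lambda>_. x)"
  by (auto simp: loop_in_def path_def path_image_def pathstart_def pathfinish_def)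

lemma loop_in_join: "loop_in S x p \<Longrightarrow> loop_in S x q \<Longrightarrow> loop_in S x (p +++ q)"
  using path_image_join_subset [of p q] by (auto simp: loop_in_def)

lemma loop_in_reversepath: "loop_in S x p \<Longrightarrow> loop_in S x (reversepath p)"
  by (simp add: loop_in_def)

lemma loop_in_loop_product:
  assumes "x \<in> S" "\<And>g. g \<in> set gs \<Longrightarrow> loop_in S x g"
  shows "loop_in S x (loop_product x gs)"
  using assms(2) by (induction gs) (auto intro: loop_in_const loop_in_join assms(1))

section \<open>Monodromy\<close>

context fuchsian_system
begin

lemma continued_solution_parallel:
  assumes "path \<gamma>" "path_image \<gamma> \<subseteq> punctured_sphere t" "pathstart \<gamma> = x0"
  obtains g where "parallel_on {0..1} \<gamma> g" "g 0 = mat 1" "continued_solution Q x0 t \<gamma> = g 1"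
proof -
  obtain g where g: "parallel_on {0..1} \<gamma> g" "g 0 = mat 1"
    using assms(1,2) by (rule parallel_on_path_exists)
  with assms show thesis
    using continued_solution_eq that by blast
qed

lemma continued_solution_join:
  assumes \<alpha>: "path \<alpha>" "path_image \<alpha> \<subseteq> punctured_sphere t" "pathstart \<alpha> = x0"
    and \<beta>: "path \<beta>" "path_image \<beta> \<subseteq> punctured_sphere t" "pathstart \<beta> = pathfinish \<alpha>"
    and a: "parallel_on {0..1} \<alpha> a" "a 0 = mat 1"
    and b: "parallel_on {0..1} \<beta> b" "b 0 = a 1"
  shows "continued_solution Q x0 t (\<alpha> +++ \<beta>) = b 1"
proof -
  have "continued_solution Q x0 t (\<alpha> +++ \<beta>) = (a +++ b) 1"
  proof (rule continued_solution_eq)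
    show "parallel_on {0..1} (\<alpha> +++ \<beta>) (a +++ b)"
      using assms by (intro parallel_on_join) auto
    show "path_image (\<alpha> +++ \<beta>) \<subseteq> punctured_sphere t"
      using \<alpha> \<beta> by (intro subset_path_image_join) auto
  qed (use assms in \<open>auto simp: joinpaths_at\<close>)
  then show ?thesis
    by (simp add: joinpaths_at)
qed

lemma continued_solution_homotopic:
  assumes hom: "homotopic_paths (punctured_sphere t) p q" and x0: "pathstart p = x0"
  shows "continued_solution Q x0 t p = continued_solution Q x0 t q"
proof -
  have p: "path p" "path_image p \<subseteq> punctured_sphere t"
    and q: "path q" "path_image q \<subseteq> punctured_sphere t" "pathstart q = x0"
    using homotopic_paths_imp_path [OF hom] homotopic_paths_imp_subset [OF hom]
      homotopic_paths_imp_pathstart [OF hom] x0 by auto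
  obtain g where g: "parallel_on {0..1} p g" "g 0 = mat 1" "continued_solution Q x0 t p = g 1"
    using p x0 by (rule continued_solution_parallel)
  obtain g' where g': "parallel_on {0..1} q g'" "g' 0 = mat 1" "continued_solution Q x0 t q = g' 1"
    using q by (rule continued_solution_parallel)
  show ?thesis
    using parallel_on_homotopic [OF hom g(1) g'(1)] g g' by simp
qed

lemma monodromy_const:
  assumes "x0 \<in> punctured_sphere t"
  shows "monodromy Q x0 (\<lambda>_. x0) t = mat 1"
  using assms loop_in_const [OF assms]
  by (intro continued_solution_eq parallel_on_const) (auto simp: loop_in_def)

text \<open>Along \<open>q\<close> the continuation starts from \<open>g 1\<close> rather than from
  the identity, and the section with that start is \<open>f\<close> times \<open>g 1\<close>. Hence
  the reversed order of the factors.\<close>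

lemma monodromy_join:
  assumes p: "loop_in (punctured_sphere t) x0 p" and q: "loop_in (punctured_sphere t) x0 q"
  shows "monodromy Q x0 (p +++ q) t = monodromy Q x0 q t ** monodromy Q x0 p t"
proof -
  obtain g where g: "parallel_on {0..1} p g" "g 0 = mat 1" "monodromy Q x0 p t = g 1"
    using p unfolding loop_in_def by (blast intro: continued_solution_parallel)
  obtain f where f: "parallel_on {0..1} q f" "f 0 = mat 1" "monodromy Q x0 q t = f 1"
    using q unfolding loop_in_def by (blast intro: continued_solution_parallel)
  have "monodromy Q x0 (p +++ q) t = f 1 ** g 1"
    using p q g f
    by (intro continued_solution_join [where b = "\<lambda>s. f s ** g 1"] parallel_on_mult)
      (auto simp: loop_in_def)
  then show ?thesis
    using f g by simp
qed

lemma monodromy_invertible: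
  assumes "loop_in (punctured_sphere t) x0 p"
  shows "invertible (monodromy Q x0 p t)"
proof -
  obtain g where g: "parallel_on {0..1} p g" "g 0 = mat 1" "monodromy Q x0 p t = g 1"
    using assms unfolding loop_in_def by (blast intro: continued_solution_parallel)
  have "invertible (g 1)"
    by (rule parallel_on_invertible [OF g(1), where p = 0])
      (use assms g(2) in \<open>auto simp: loop_in_def path_def invertible_det_nz\<close>)
  then show ?thesis
    using g by simp
qed

text \<open>The reversed section starts at \<open>g 1\<close>; the right factor \<open>N\<close>
  restores the initial value 1.\<close>

lemma monodromy_reversepath:
  assumes "loop_in (punctured_sphere t) x0 p"
  shows "monodromy Q x0 p t ** monodromy Q x0 (reversepath p) t = mat 1"
proof -
  obtain g where g: "parallel_on {0..1} p g" "g 0 = mat 1" "monodromy Q x0 p t = g 1"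
    using assms unfolding loop_in_def by (blast intro: continued_solution_parallel)
  obtain N where N: "g 1 ** N = mat 1"
    using monodromy_invertible [OF assms] g(3) unfolding invertible_def by auto
  have "monodromy Q x0 (reversepath p) t = reversepath g 1 ** N"
    using loop_in_reversepath [OF assms] N
    by (intro continued_solution_eq parallel_on_mult parallel_on_reversepath g)
      (auto simp: loop_in_def reversepath_def)
  then show ?thesis
    using g N by (simp add: reversepath_def)
qed

text \<open>The representation by \<open>H\<close> and \<open>E\<close> speaks of
  \<open>\<alpha>\<close> followed by a path in the disc; the constant path lets it be evaluated at
  the end of \<open>\<alpha>\<close>.\<close>

lemma continued_solution_join_const:
  assumes \<alpha>: "path \<alpha>" "path_image \<alpha> \<subseteq> punctured_sphere t" "pathstart \<alpha> = x0"
  shows "continued_solution Q x0 t (\<alpha> +++ (\<lambda>_. pathfinish \<alpha>)) = continued_solution Q x0 t \<alpha>"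
proof -
  have fin: "pathfinish \<alpha> \<in> punctured_sphere t"
    using \<alpha>(2) by auto
  note const = loop_in_const [OF fin, unfolded loop_in_def]
  obtain a where a: "parallel_on {0..1} \<alpha> a" "a 0 = mat 1" "continued_solution Q x0 t \<alpha> = a 1"
    using \<alpha> by (rule continued_solution_parallel)
  have "continued_solution Q x0 t (\<alpha> +++ (\<lambda>_. pathfinish \<alpha>)) = a 1"
    using \<alpha> a fin const
    by (intro continued_solution_join [where b = "\<lambda>_. a 1"] parallel_on_const) auto
  then show ?thesis
    using a by simp
qed

text \<open>The reversed section along \<open>\<alpha>\<close>, multiplied by \<open>M\<close>, fits
  the value reached after \<open>\<beta>\<close>; it ends at \<open>M\<close> because the section
  along \<open>\<alpha>\<close> began at the identity.\<close>

lemma continued_solution_lasso: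
  assumes \<alpha>: "path \<alpha>" "path_image \<alpha> \<subseteq> punctured_sphere t" "pathstart \<alpha> = x0"
    and \<beta>: "loop_in (punctured_sphere t) (pathfinish \<alpha>) \<beta>"
    and M: "continued_solution Q x0 t (\<alpha> +++ \<beta>) = continued_solution Q x0 t \<alpha> ** M"
  shows "continued_solution Q x0 t (\<alpha> +++ \<beta> +++ reversepath \<alpha>) = M"
proof -
  have \<beta>': "path \<beta>" "path_image \<beta> \<subseteq> punctured_sphere t"
    "pathstart \<beta> = pathfinish \<alpha>" "pathfinish \<beta> = pathfinish \<alpha>"
    using \<beta> by (auto simp: loop_in_def)
  obtain a where a: "parallel_on {0..1} \<alpha> a" "a 0 = mat 1" "continued_solution Q x0 t \<alpha> = a 1"
    using \<alpha> by (rule continued_solution_parallel)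
  obtain b where b: "parallel_on {0..1} \<beta> b" "b 0 = a 1"
    using \<beta>'(1,2) by (rule parallel_on_path_exists)
  define r where "r s = reversepath a s ** M" for s
  have "continued_solution Q x0 t (\<alpha> +++ \<beta>) = b 1"
    using \<alpha> \<beta>' a b by (intro continued_solution_join)
  then have "b 1 = r 0"
    using M a(3) by (simp add: r_def reversepath_def)
  moreover have "parallel_on {0..1} (reversepath \<alpha>) r"
    unfolding r_def by (intro parallel_on_mult parallel_on_reversepath a)
  ultimately have "parallel_on {0..1} (\<beta> +++ reversepath \<alpha>) (b +++ r)"
    using \<alpha> \<beta>' b by (intro parallel_on_join) auto
  moreover have "path_image (\<beta> +++ reversepath \<alpha>) \<subseteq> punctured_sphere t"
    using \<alpha> \<beta>' by (intro subset_path_image_join) auto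
  ultimately have "continued_solution Q x0 t (\<alpha> +++ \<beta> +++ reversepath \<alpha>) = (b +++ r) 1"
    using \<alpha> \<beta>' a b by (intro continued_solution_join) (auto simp: joinpaths_at)
  also have "\<dots> = M"
    using a by (simp add: joinpaths_at r_def reversepath_def)
  finally show ?thesis .
qed

text \<open>\<open>G\<close> is the continued solution as a function of \<open>w = log (x - c)\<close>.\<close>

lemma parallel_on_log_cover:
  assumes \<alpha>: "path \<alpha>" "path_image \<alpha> \<subseteq> punctured_sphere t" "pathstart \<alpha> = x0"
      "pathfinish \<alpha> = Fin (c + exp l0)"
    and disc: "\<And>x. x \<in> ball c \<rho> - {c} \<Longrightarrow> Fin x \<in> punctured_sphere t"
    and \<rho>: "\<rho> > 0" and l0: "Re l0 < ln \<rho>"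
    and rep: "\<And>\<mu> l. path \<mu> \<Longrightarrow> path_image \<mu> \<subseteq> ball c \<rho> - {c} \<Longrightarrow> pathstart \<mu> = c + exp l0 \<Longrightarrow>
      continuous_on {0..1} l \<Longrightarrow> \<forall>s\<in>{0..1}. exp (l s) = \<mu> s - c \<Longrightarrow> l 0 = l0 \<Longrightarrow>
      continued_solution Q x0 t (\<alpha> +++ (Fin \<circ> \<mu>)) = G (l 1)"
  shows "parallel_on {w. Re w < ln \<rho>} (\<lambda>w. Fin (c + exp w)) G"
proof -
  define e where "e w = c + exp w" for w
  define A where "A = {w. Re w < ln \<rho>}"
  define h where "h = Fin \<circ> e"
  have convA: "convex A"
    unfolding A_def by (rule convex_halfspace_Re_lt)
  have openA: "open A"
    unfolding A_def by (rule open_halfspace_Re_lt)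
  have eA: "e w \<in> ball c \<rho> - {c}" if "w \<in> A" for w
  proof -
    have "exp (Re w) < exp (ln \<rho>)"
      using that by (simp add: A_def)
    then show ?thesis
      using \<rho> by (simp add: e_def dist_norm)
  qed
  have conte: "continuous_on B e" for B
    unfolding e_def by (intro continuous_intros)
  have conth: "continuous_on B h" for B
    unfolding h_def by (intro continuous_on_compose conte continuous_on_Fin)
  have hA: "h w \<in> punctured_sphere t" if "w \<in> A" for w
    using disc eA [OF that] by (simp add: h_def)
  have path_h: "path (h \<circ> l)" "path_image (h \<circ> l) \<subseteq> punctured_sphere t"
    if "path l" "path_image l \<subseteq> A" for l
    using that hA by (auto intro: path_continuous_image conth simp: path_image_compose)
  \<comment> \<open>For a path lifted to the half plane, parallel transport must reproduce
    \<open>G\<close> at its end; this turns the hypothesis on continuations into a statement about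
    \<open>G\<close>.\<close>
  have rep': "G (pathfinish l) = n 1"
    if l: "path l" "path_image l \<subseteq> A" "pathstart l = l0"
      and a: "parallel_on {0..1} \<alpha> a" "a 0 = mat 1"
      and n: "parallel_on {0..1} (h \<circ> l) n" "n 0 = a 1" for l a n
  proof -
    have start: "pathfinish \<alpha> = pathstart (h \<circ> l)"
      using \<alpha>(4) l(3) by (simp add: pathstart_compose h_def e_def)
    have "continued_solution Q x0 t (\<alpha> +++ (h \<circ> l)) = n 1"
      using \<alpha> a n start path_h [OF l(1,2)]
      by (intro continued_solution_join [where \<beta> = "h \<circ> l"]) auto
    moreover have "continued_solution Q x0 t (\<alpha> +++ (Fin \<circ> (e \<circ> l))) = G (l 1)"
    proof (rule rep)
      show "path (e \<circ> l)"
        using l(1) conte by (rule path_continuous_image)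
      show "path_image (e \<circ> l) \<subseteq> ball c \<rho> - {c}"
        using l(2) eA by (auto simp: path_image_compose)
      show "pathstart (e \<circ> l) = c + exp l0"
        using l(3) by (simp add: pathstart_compose e_def)
      show "continuous_on {0..1} l"
        using l(1) by (simp add: path_def)
      show "l 0 = l0"
        using l(3) by (simp add: pathstart_def)
    qed (simp add: e_def)
    ultimately show ?thesis
      by (simp add: h_def comp_assoc pathfinish_def)
  qed
  have l0A: "l0 \<in> A"
    using l0 by (simp add: A_def)
  obtain a where a: "parallel_on {0..1} \<alpha> a" "a 0 = mat 1"
    using \<alpha>(1,2) by (rule parallel_on_path_exists)
  have "parallel_on A h G"
    unfolding parallel_on_def
  proof
    fix w1 assume w1: "w1 \<in> A"
    obtain U \<Phi> where U: "solution_frame U \<Phi>" "h w1 \<in> U"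
      using frame_exists [OF hA [OF w1]] by blast
    have "open (h -` U)"
      using frame_open [OF U(1)] conth by (rule open_vimage)
    then have "open (h -` U \<inter> A)"
      using openA by (rule open_Int)
    then obtain r where r: "r > 0" "ball w1 r \<subseteq> h -` U \<inter> A"
      using U(2) w1 by (meson IntI openE vimageI)
    obtain N where N: "\<Phi> (h w1) ** N = mat 1"
      using frame_invertible [OF U] unfolding invertible_def by blast
    define C where "C = N ** G w1"
    have C: "\<Phi> (h w1) ** C = G w1"
      by (simp add: C_def matrix_mul_assoc N)
    have seg1: "path_image (linepath l0 w1) \<subseteq> A"
      using convA l0A w1 by (simp add: closed_segment_subset)
    obtain n1 where n1: "parallel_on {0..1} (h \<circ> linepath l0 w1) n1" "n1 0 = a 1"
      using path_h [OF path_linepath seg1] by (rule parallel_on_path_exists)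
    have n1_end: "n1 1 = G w1"
      using rep' [OF path_linepath seg1 _ a n1] by simp
    have "G w = \<Phi> (h w) ** C" if w: "w \<in> ball w1 r" for w
    proof -
      \<comment> \<open>The half plane is convex, so segments serve as lifted paths: from
        \<open>l0\<close> to \<open>w1\<close>, then to \<open>w\<close> inside a ball that is
        mapped into a single frame domain. Thus one constant \<open>C\<close> serves all
        \<open>w\<close> in the ball.\<close>
      define l where "l = linepath l0 w1 +++ linepath w1 w"
      define n2 where "n2 s = \<Phi> ((h \<circ> linepath w1 w) s) ** C" for s
      have seg2: "path_image (linepath w1 w) \<subseteq> h -` U \<inter> A"
        using w r closed_segment_subset [OF _ _ convex_ball, of w1 w1 r w] by auto
      have n2: "parallel_on {0..1} (h \<circ> linepath w1 w) n2"
        unfolding n2_def using seg2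
        by (intro parallel_on_in_frame [OF U(1)]) (auto simp: path_image_def)
      have "path_image l \<subseteq> A"
        unfolding l_def using seg1 seg2 by (intro subset_path_image_join) auto
      then have l: "path l" "path_image l \<subseteq> A" "pathstart l = l0" "pathfinish l = w"
        by (auto simp: l_def)
      have "parallel_on {0..1} ((h \<circ> linepath l0 w1) +++ (h \<circ> linepath w1 w)) (n1 +++ n2)"
        using n1 n2 path_h(1) [OF path_linepath seg1] path_h(1) [OF path_linepath, of w1 w] seg2
        by (intro parallel_on_join)
          (auto simp: n2_def n1_end C pathstart_compose pathfinish_compose linepath_0')
      then have "parallel_on {0..1} (h \<circ> l) (n1 +++ n2)"
        by (simp add: l_def path_compose_join)
      moreover have "(n1 +++ n2) 0 = a 1"
        using n1(2) by (simp add: joinpaths_at)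
      ultimately have "G (pathfinish l) = (n1 +++ n2) 1"
        using rep' [OF l(1-3) a] by blast
      then show ?thesis
        by (simp add: l(4) joinpaths_at n2_def linepath_1')
    qed
    then have "\<forall>\<^sub>F w in nhds w1. w \<in> A \<longrightarrow> G w = \<Phi> (h w) ** C"
      using r(1) by (auto simp: eventually_nhds_metric dist_commute)
    with U show "\<exists>U \<Phi> C. solution_frame U \<Phi> \<and> h w1 \<in> U \<and>
        (\<forall>\<^sub>F w in nhds w1. w \<in> A \<longrightarrow> G w = \<Phi> (h w) ** C)"
      by blast
  qed
  then show ?thesis
    by (simp add: A_def h_def e_def comp_def)
qed

text \<open>The shift keeps \<open>Re w\<close> and leaves \<open>h\<close> unchanged, so the
  shifted section and \<open>G\<close> times \<open>M\<close> are parallel over the same map;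
  equality at \<open>l0\<close> decides.\<close>

lemma parallel_on_log_cover_periodic:
  assumes G: "parallel_on {w. Re w < r} (\<lambda>w. Fin (c + exp w)) G"
    and l0: "Re l0 < r" and M: "G (l0 + 2 * of_real pi * \<i>) = G l0 ** M" and w: "Re w < r"
  shows "G (w + 2 * of_real pi * \<i>) = G w ** M"
proof -
  define A where "A = {w. Re w < r}"
  define h where "h w = Fin (c + exp w)" for w
  define T where "T w = w + 2 * of_real pi * \<i>" for w
  have h: "continuous_on A h"
    unfolding h_def
    by (rule continuous_on_compose2 [OF continuous_on_Fin [of UNIV]]) (auto intro!: continuous_intros)
  have GA: "parallel_on A h G"
    using G by (simp add: A_def h_def [abs_def])
  have "parallel_on A (h \<circ> T) (G \<circ> T)"
    by (rule parallel_on_compose [OF GA]) (auto simp: A_def T_def intro!: continuous_intros)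
  moreover have "h \<circ> T = h"
    by (auto simp: h_def T_def fun_eq_iff exp_add)
  ultimately have "parallel_on A h (G \<circ> T)"
    by simp
  then have "(G \<circ> T) w = (\<lambda>w. G w ** M) w"
    using parallel_on_mult [OF GA] h
    by (rule parallel_on_unique [where p = l0])
      (use l0 w M in \<open>auto simp: A_def T_def intro: convex_connected convex_halfspace_Re_lt\<close>)
  then show ?thesis
    by (simp add: T_def)
qed

end

section \<open>Comparison of nearby values of \<open>t\<close>\<close>

lemma monodromy_loop_product_cong:
  assumes sys: "fuchsian_system Q t" "fuchsian_system Q t'"
    and x0: "x0 \<in> punctured_sphere t" "x0 \<in> punctured_sphere t'"
    and gs: "\<And>g. g \<in> set gs \<Longrightarrow> loop_in (punctured_sphere t) x0 g \<and>
      loop_in (punctured_sphere t') x0 g \<and> monodromy Q x0 g t = monodromy Q x0 g t'"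
  shows "monodromy Q x0 (loop_product x0 gs) t = monodromy Q x0 (loop_product x0 gs) t'"
  using gs
proof (induction gs)
  case Nil
  then show ?case
    using sys x0 by (simp add: fuchsian_system.monodromy_const)
next
  case (Cons g gs)
  have "loop_in (punctured_sphere t) x0 (loop_product x0 gs)"
    "loop_in (punctured_sphere t') x0 (loop_product x0 gs)"
    using Cons.prems x0 by (auto intro: loop_in_loop_product)
  then show ?case
    using Cons sys by (simp add: fuchsian_system.monodromy_join)
qed

text \<open>Both reversed loops give right inverses of one and the same invertible matrix.\<close>

lemma monodromy_reversepath_cong:
  assumes sys: "fuchsian_system Q t" "fuchsian_system Q t'"
    and g: "loop_in (punctured_sphere t) x0 g" "loop_in (punctured_sphere t') x0 g"
    and eq: "monodromy Q x0 g t = monodromy Q x0 g t'"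
  shows "monodromy Q x0 (reversepath g) t = monodromy Q x0 (reversepath g) t'"
proof -
  have "monodromy Q x0 g t ** monodromy Q x0 (reversepath g) t =
      monodromy Q x0 g t ** monodromy Q x0 (reversepath g) t'"
    using fuchsian_system.monodromy_reversepath [OF sys(1) g(1)]
      fuchsian_system.monodromy_reversepath [OF sys(2) g(2)] eq by simp
  then show ?thesis
    using fuchsian_system.monodromy_invertible [OF sys(1) g(1)]
    by (simp add: invertible_mult_left_cancel)
qed

lemma polydisc_mono: "r \<le> s \<Longrightarrow> polydisc t0 r \<subseteq> polydisc t0 s"
  by (auto simp: polydisc_def intro: less_le_trans)

lemma centre_in_polydisc: "r > 0 \<Longrightarrow> t0 \<in> polydisc t0 r"
  by (simp add: polydisc_def)

text \<open>The complement of the compact set is an open neighbourhood of each pole, and there are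
  finitely many poles.\<close>

lemma compact_subset_punctured_sphere_nearby:
  fixes t0 :: "complex ^ 'n::finite"
  assumes K: "compact K" "K \<subseteq> punctured_sphere t0"
  obtains r where "r > 0" "\<And>t. t \<in> polydisc t0 r \<Longrightarrow> K \<subseteq> punctured_sphere t"
proof -
  have "open (Fin -` (- K))"
    using K(1) by (intro open_Fin_vimage open_Compl compact_imp_closed)
  moreover have "t0 $ p \<in> Fin -` (- K)" for p
    using K(2) by (auto simp: punctured_sphere_def)
  ultimately have "\<exists>e>0. ball (t0 $ p) e \<subseteq> Fin -` (- K)" for p
    by (meson openE)
  then obtain e where e: "\<And>p. e p > 0" "\<And>p. ball (t0 $ p) (e p) \<subseteq> Fin -` (- K)"
    by metis
  define r where "r = Min (range e)"
  have r: "r > 0" "r \<le> e p" for p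
    using e(1) by (auto simp: r_def)
  show thesis
  proof (rule that [OF r(1)])
    fix t assume t: "t \<in> polydisc t0 r"
    have "Fin (t $ p) \<notin> K" for p
    proof -
      have "t $ p \<in> ball (t0 $ p) (e p)"
        using t r(2) [of p] by (auto simp: polydisc_def intro: less_le_trans)
      then show ?thesis
        using e(2) by blast
    qed
    then show "K \<subseteq> punctured_sphere t"
      by (auto simp: punctured_sphere_def)
  qed
qed

lemma homotopic_paths_punctured_sphere_nearby:
  fixes t0 :: "complex ^ 'n::finite"
  assumes "homotopic_paths (punctured_sphere t0) p q"
  obtains r where "r > 0" "\<And>t. t \<in> polydisc t0 r \<Longrightarrow> homotopic_paths (punctured_sphere t) p q"
proof -
  obtain h where h: "continuous_on ({0..1} \<times> {0..1}) h"
    "h ` ({0..1} \<times> {0..1}) \<subseteq> punctured_sphere t0"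
    and rest: "\<forall>x\<in>{0..1}. h (0, x) = p x" "\<forall>x\<in>{0..1}. h (1, x) = q x"
      "\<forall>t\<in>{0..1::real}. pathstart (h \<circ> Pair t) = pathstart p \<and> pathfinish (h \<circ> Pair t) = pathfinish p"
    using assms unfolding homotopic_paths by (auto simp: image_subset_iff_funcset)
  have "compact (h ` ({0..1} \<times> {0..1}))"
    using h(1) by (intro compact_continuous_image compact_Times) auto
  from compact_subset_punctured_sphere_nearby [OF this h(2)] obtain r where
    r: "r > 0" "\<And>t. t \<in> polydisc t0 r \<Longrightarrow> h ` ({0..1} \<times> {0..1}) \<subseteq> punctured_sphere t"
    by blast
  show thesis
  proof (rule that [OF r(1)])
    fix t assume "t \<in> polydisc t0 r"
    then show "homotopic_paths (punctured_sphere t) p q"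
      unfolding homotopic_paths using h(1) rest r(2)
      by (intro exI [of _ h]) (simp add: image_subset_iff_funcset)
  qed
qed

lemma fuchsian_deformation_system:
  "fuchsian_deformation D Q \<Longrightarrow> t \<in> D \<Longrightarrow> fuchsian_system Q t"
  by (simp add: fuchsian_deformation_def fuchsian_system_def)

section \<open>Isoprincipal deformations\<close>

locale isoprincipal_at_pole =
  fixes D :: "(complex ^ 'n::finite) set"
    and Q :: "'n \<Rightarrow> complex ^ 'n \<Rightarrow> 'k::finite cmatrix"
    and x0 :: riemann_sphere and t0 :: "complex ^ 'n" and j :: 'n
    and \<rho> \<delta> :: real and xj :: complex and \<theta> :: real and \<alpha> :: "real \<Rightarrow> riemann_sphere"
    and H :: "complex \<Rightarrow> complex ^ 'n \<Rightarrow> 'k cmatrix" and E :: "complex \<Rightarrow> 'k cmatrix"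
  assumes deformation: "fuchsian_deformation D Q"
    and isoprincipal: "isoprincipal_representation D Q x0 t0 j \<rho> \<delta> xj \<theta> \<alpha> H E"
begin

lemma admissible: "admissible_path D x0 t0 j \<rho> \<delta> xj \<alpha>"
  using isoprincipal by (simp add: isoprincipal_representation_def)

lemma radii: "0 < \<rho>" "0 < \<delta>" "2 * \<delta> < \<rho>" "\<delta> < cmod (xj - t0 $ j)" "cmod (xj - t0 $ j) < \<rho> - \<delta>"
  and polydisc_subset: "polydisc t0 \<delta> \<subseteq> D"
  and \<alpha>_path: "path \<alpha>" "pathstart \<alpha> = x0" "pathfinish \<alpha> = Fin xj"
  using admissible by (simp_all add: admissible_path_def)

lemma system: "t \<in> polydisc t0 \<delta> \<Longrightarrow> fuchsian_system Q t"
  using deformation polydisc_subset by (auto intro: fuchsian_deformation_system)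

lemma dist_pole: "t \<in> polydisc t0 \<delta> \<Longrightarrow> cmod (t $ p - t0 $ p) < \<delta>"
  by (simp add: polydisc_def dist_norm norm_minus_commute)

lemma \<alpha>_subset:
  assumes t: "t \<in> polydisc t0 \<delta>"
  shows "path_image \<alpha> \<subseteq> punctured_sphere t"
proof -
  have "Fin (t $ p) \<notin> path_image \<alpha>" for p
    using admissible dist_pole [OF t, of p] unfolding admissible_path_def by (meson less_asym)
  then show ?thesis
    by (auto simp: punctured_sphere_def)
qed

lemma punctured_disc_subset:
  assumes t: "t \<in> polydisc t0 \<delta>" and x: "x \<in> ball (t $ j) \<rho> - {t $ j}"
  shows "Fin x \<in> punctured_sphere t"
proof -
  have "x \<noteq> t $ p" for p
  proof (cases "p = j")
    case False
    then have "\<rho> \<le> cmod (t0 $ j - t0 $ p) / 2"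
      using admissible by (auto simp: admissible_path_def)
    \<comment> \<open>Each of the two poles moves by less than \<open>\<delta>\<close>, so their
      distance stays above \<open>2 * \<rho> - 2 * \<delta>\<close>, which exceeds
      \<open>\<rho>\<close> as \<open>2 * \<delta> < \<rho>\<close>.\<close>
    moreover have "cmod (t0 $ j - t0 $ p) \<le> cmod (t $ j - t0 $ j) + cmod (t $ p - t0 $ p) + cmod (t $ j - t $ p)"
      by norm
    moreover have "cmod (t $ j - t0 $ j) < \<delta>" "cmod (t $ p - t0 $ p) < \<delta>"
      using t by (auto intro: dist_pole)
    ultimately have "\<rho> < cmod (t $ j - t $ p)"
      using radii by linarith
    then show ?thesis
      using x by (auto simp: dist_norm)
  qed (use x in auto)
  then show ?thesis
    by (auto simp: punctured_sphere_def)
qed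

text \<open>The circle is centred at \<open>t0 $ j\<close>, the disc at \<open>t $ j\<close>, and
  these differ by less than \<open>\<delta>\<close>. A radius above \<open>\<delta>\<close> keeps
  the circle off \<open>t $ j\<close>; a radius below \<open>\<rho> - \<delta>\<close> keeps it
  inside the disc.\<close>

lemma circle_subset:
  assumes t: "t \<in> polydisc t0 \<delta>"
  shows "circle_from (t0 $ j) xj s \<in> ball (t $ j) \<rho> - {t $ j}"
proof -
  have "cmod (exp (2 * of_real pi * \<i> * of_real s)) = 1"
    by (simp add: norm_exp)
  then have "cmod (circle_from (t0 $ j) xj s - t0 $ j) = cmod (xj - t0 $ j)"
    by (simp add: circle_from_def norm_mult)
  moreover have "cmod (t $ j - t0 $ j) < \<delta>"
    using t by (rule dist_pole)
  moreover have "cmod (t $ j - circle_from (t0 $ j) xj s) \<le>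
      cmod (circle_from (t0 $ j) xj s - t0 $ j) + cmod (t $ j - t0 $ j)"
    by norm
  ultimately show ?thesis
    using radii by (auto simp: dist_norm)
qed

lemma circle_loop:
  assumes t: "t \<in> polydisc t0 \<delta>"
  shows "loop_in (ball (t $ j) \<rho> - {t $ j}) xj (circle_from (t0 $ j) xj)"
proof -
  have "continuous_on {0..1} (circle_from (t0 $ j) xj)"
    unfolding circle_from_def by (intro continuous_intros)
  then show ?thesis
    using circle_subset [OF t]
    by (auto simp: loop_in_def path_def path_image_def pathstart_def pathfinish_def circle_from_def)
qed

lemma Fin_circle_loop:
  assumes t: "t \<in> polydisc t0 \<delta>"
  shows "loop_in (punctured_sphere t) (Fin xj) (Fin \<circ> circle_from (t0 $ j) xj)"
proof -
  have "Fin ` (ball (t $ j) \<rho> - {t $ j}) \<subseteq> punctured_sphere t"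
    using punctured_disc_subset [OF t] by blast
  then show ?thesis
    using circle_loop [OF t] unfolding loop_in_def
    by (auto simp: path_image_compose pathstart_compose pathfinish_compose simp del: mem_ball
        intro!: path_continuous_image continuous_on_Fin)
qed

lemma generated_loop_loop_in:
  assumes t: "t \<in> polydisc t0 \<delta>"
  shows "loop_in (punctured_sphere t) x0 (generated_loop (t0 $ j) xj \<alpha>)"
proof -
  have "path_image (generated_loop (t0 $ j) xj \<alpha>) \<subseteq> punctured_sphere t"
    unfolding generated_loop_def using Fin_circle_loop [OF t] \<alpha>_subset [OF t]
    by (intro subset_path_image_join) (auto simp: loop_in_def)
  then show ?thesis
    using Fin_circle_loop [OF t] \<alpha>_path by (auto simp: loop_in_def generated_loop_def)
qed

text \<open>Since \<open>|t $ j - t0 $ j| < |xj - t0 $ j|\<close>, the quotient of \<open>x - t $ j\<close> and \<open>x - t0 $ j\<close>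
  stays in the right half plane along the circle, so its principal logarithm corrects a branch of
  \<open>log (x - t0 $ j)\<close> to one of \<open>log (x - t $ j)\<close>.\<close>

definition circle_log :: "complex ^ 'n \<Rightarrow> real \<Rightarrow> complex" where
  "circle_log t s = Complex (ln (cmod (xj - t0 $ j))) \<theta> + 2 * of_real pi * \<i> * of_real s +
     Ln (1 - (t $ j - t0 $ j) / (circle_from (t0 $ j) xj s - t0 $ j))"

text \<open>At \<open>s = 0\<close> the correction has argument of modulus less than
  \<open>pi / 2\<close>, which is exactly the window around \<open>\<theta>\<close>. At
  \<open>s = 1\<close> the correction returns to its first value with the circle, so only the linear
  term contributes.\<close>

lemma circle_log:
  assumes t: "t \<in> polydisc t0 \<delta>"
  shows "continuous_on {0..1} (circle_log t)"
    and "exp (circle_log t s) = circle_from (t0 $ j) xj s - t $ j"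
    and "\<theta> - pi / 2 < Im (circle_log t 0)" "Im (circle_log t 0) < \<theta> + pi / 2"
    and "circle_log t 1 = circle_log t 0 + 2 * of_real pi * \<i>"
proof -
  define z where "z = xj - t0 $ j"
  define y where "y s = circle_from (t0 $ j) xj s - t0 $ j" for s
  have y: "y s = z * exp (2 * of_real pi * \<i> * of_real s)" for s
    by (simp add: y_def z_def circle_from_def)
  have norm_y: "cmod (y s) = cmod z" for s
    by (simp add: y norm_mult norm_exp)
  have z: "z \<noteq> 0"
    using radii by (auto simp: z_def)
  have y0: "y s \<noteq> 0" for s
    using norm_y [of s] z by auto
  have pos: "Re (1 - (t $ j - t0 $ j) / y s) > 0" for s
  proof -
    have "cmod ((t $ j - t0 $ j) / y s) < 1"
      using dist_pole [OF t, of j] radii norm_y [of s] z by (simp add: norm_divide z_def)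
    then show ?thesis
      using complex_Re_le_cmod [of "(t $ j - t0 $ j) / y s"] by simp
  qed
  have log: "circle_log t = (\<lambda>s. Complex (ln (cmod z)) \<theta> + 2 * of_real pi * \<i> * of_real s +
      Ln (1 - (t $ j - t0 $ j) / y s))"
    by (simp add: circle_log_def [abs_def] z_def y_def)
  have "continuous_on {0..1} y"
    unfolding y by (intro continuous_intros)
  then show "continuous_on {0..1} (circle_log t)"
    unfolding log using y0 pos
    by (intro continuous_intros) (auto simp: complex_nonpos_Reals_iff not_le)
  have "exp (Complex (ln (cmod z)) \<theta>) = z"
    using isoprincipal z
    by (simp add: isoprincipal_representation_def is_Arg_def z_def Complex_eq exp_add exp_of_real mult.commute)
  moreover have "1 - (t $ j - t0 $ j) / y s \<noteq> 0"
    using pos [of s] by auto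
  ultimately have "exp (circle_log t s) = y s * (1 - (t $ j - t0 $ j) / y s)"
    by (simp add: log exp_add y)
  also have "\<dots> = y s - (t $ j - t0 $ j)"
    using y0 [of s] by (simp add: field_simps)
  finally show "exp (circle_log t s) = circle_from (t0 $ j) xj s - t $ j"
    by (simp add: y_def)
  have "\<bar>Im (Ln (1 - (t $ j - t0 $ j) / y 0))\<bar> < pi / 2"
    using pos [of 0] by (subst Re_Ln_pos_lt) auto
  then show "\<theta> - pi / 2 < Im (circle_log t 0)" "Im (circle_log t 0) < \<theta> + pi / 2"
    by (auto simp: log)
  have "y 1 = y 0"
    by (simp add: y)
  then show "circle_log t 1 = circle_log t 0 + 2 * of_real pi * \<i>"
    by (simp add: log)
qed

text \<open>Fixing the initial branch as \<open>circle_log t 0\<close> settles the window condition.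
  Writing the end point through \<open>exp (l 1)\<close> makes the right-hand side a function of
  \<open>l 1\<close> alone, the form needed in the logarithmic coordinate.\<close>

lemma representation:
  assumes "t \<in> polydisc t0 \<delta>" "path \<mu>" "path_image \<mu> \<subseteq> ball (t $ j) \<rho> - {t $ j}" "pathstart \<mu> = xj"
    "continuous_on {0..1} l" "\<forall>s\<in>{0..1}. exp (l s) = \<mu> s - t $ j" "l 0 = circle_log t 0"
  shows "continued_solution Q x0 t (\<alpha> +++ (Fin \<circ> \<mu>)) = H (t $ j + exp (l 1)) t ** E (l 1)"
proof -
  have "continued_solution Q x0 t (\<alpha> +++ (Fin \<circ> \<mu>)) = H (pathfinish \<mu>) t ** E (l 1)"
  proof -
    have "\<forall>t\<in>polydisc t0 \<delta>. \<forall>\<mu> l.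
        path \<mu> \<and> path_image \<mu> \<subseteq> ball (t $ j) \<rho> - {t $ j} \<and> pathstart \<mu> = xj \<and>
        continuous_on {0..1} l \<and> (\<forall>s\<in>{0..1}. exp (l s) = \<mu> s - t $ j) \<and>
        \<theta> - pi / 2 < Im (l 0) \<and> Im (l 0) < \<theta> + pi / 2 \<longrightarrow>
        continued_solution Q x0 t (\<alpha> +++ (Fin \<circ> \<mu>)) = H (pathfinish \<mu>) t ** E (l 1)"
      using isoprincipal unfolding isoprincipal_representation_def by (elim conjE)
    from this [rule_format, OF assms(1), of \<mu> l] show ?thesis
      using assms(2-7) circle_log(3,4) [OF assms(1)] by simp
  qed
  moreover have "pathfinish \<mu> = t $ j + exp (l 1)"
    using assms(6) by (simp add: pathfinish_def)
  ultimately show ?thesis by simp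
qed

lemma E_invertible: "invertible (E w)"
  and E_holomorphic: "(\<lambda>w. E w $ i $ k) holomorphic_on UNIV"
  and H_invertible: "t \<in> polydisc t0 \<delta> \<Longrightarrow> x \<in> ball (t $ j) \<rho> \<Longrightarrow> invertible (H x t)"
  using isoprincipal by (simp_all add: isoprincipal_representation_def)

lemma E_periodic:
  obtains M where "invertible M" "\<And>w. E (w + 2 * of_real pi * \<i>) = E w ** M"
proof -
  have t0: "t0 \<in> polydisc t0 \<delta>"
    using radii by (intro centre_in_polydisc)
  interpret fuchsian_system Q t0
    using t0 by (rule system)
  define l0 where "l0 = circle_log t0 0"
  define G where "G w = H (t0 $ j + exp w) t0 ** E w" for w
  have l0: "exp l0 = xj - t0 $ j"
    using circle_log(2) [OF t0, of 0] by (simp add: l0_def circle_from_def)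
  have "exp (Re l0) < exp (ln \<rho>)"
    using radii l0 norm_exp_eq_Re [of l0] by simp
  then have Re_l0: "Re l0 < ln \<rho>"
    by simp
  have G: "parallel_on {w. Re w < ln \<rho>} (\<lambda>w. Fin (t0 $ j + exp w)) G"
  proof (rule parallel_on_log_cover [OF \<alpha>_path(1) \<alpha>_subset [OF t0] \<alpha>_path(2)])
    show "continued_solution Q x0 t0 (\<alpha> +++ (Fin \<circ> \<mu>)) = G (l 1)"
      if "path \<mu>" "path_image \<mu> \<subseteq> ball (t0 $ j) \<rho> - {t0 $ j}" "pathstart \<mu> = t0 $ j + exp l0"
        "continuous_on {0..1} l" "\<forall>s\<in>{0..1}. exp (l s) = \<mu> s - t0 $ j" "l 0 = l0" for \<mu> l
      using representation [OF t0 that(1,2) _ that(4,5)] that(3,6) l0 by (simp add: G_def l0_def)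
  qed (use t0 \<alpha>_path \<alpha>_subset punctured_disc_subset radii l0 Re_l0 in auto)
  obtain N where N: "E l0 ** N = mat 1" "N ** E l0 = mat 1"
    using E_invertible unfolding invertible_def by blast
  \<comment> \<open>The value forced by the relation at the single point \<open>l0\<close>.\<close>
  define M where "M = N ** E (l0 + 2 * of_real pi * \<i>)"
  have E_M: "E l0 ** M = E (l0 + 2 * of_real pi * \<i>)"
    by (simp add: M_def matrix_mul_assoc N)
  have "invertible N"
    using N unfolding invertible_def by blast
  then have "invertible M"
    unfolding M_def by (intro invertible_mult E_invertible)
  have near: "E (w + 2 * of_real pi * \<i>) = E w ** M" if w: "Re w < ln \<rho>" for w
  proof -
    have "exp (w + 2 * of_real pi * \<i>) = exp w" for w
      by (simp add: exp_add)
    moreover have "G (w + 2 * of_real pi * \<i>) = G w ** M"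
      by (rule parallel_on_log_cover_periodic [OF G Re_l0 _ w])
        (simp add: G_def exp_add matrix_mul_assoc [symmetric] E_M)
    \<comment> \<open>\<open>H\<close> sees \<open>w\<close> only through \<open>exp w\<close>,
      which the shift preserves, so the same factor stands on both sides and can be
      cancelled.\<close>
    ultimately have "H (t0 $ j + exp w) t0 ** E (w + 2 * of_real pi * \<i>) =
        H (t0 $ j + exp w) t0 ** (E w ** M)"
      by (simp add: G_def matrix_mul_assoc)
    moreover have "exp (Re w) < exp (ln \<rho>)"
      using w by simp
    then have "t0 $ j + exp w \<in> ball (t0 $ j) \<rho>"
      using radii by (simp add: dist_norm)
    then have "invertible (H (t0 $ j + exp w) t0)"
      by (rule H_invertible [OF t0])
    ultimately show ?thesis
      by (simp add: invertible_mult_left_cancel)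
  qed
  \<comment> \<open>Beyond \<open>Re w < ln \<rho>\<close> there is no \<open>H\<close> to compare
    with, but the entries of \<open>E\<close> are entire in \<open>w\<close> and the half plane is
    open and nonempty.\<close>
  have "E (w + 2 * of_real pi * \<i>) $ i $ k = (E w ** M) $ i $ k" for w i k
  proof (rule analytic_continuation_open [where s = "{w. Re w < ln \<rho>}" and s' = UNIV
        and f = "\<lambda>w. E (w + 2 * of_real pi * \<i>) $ i $ k" and g = "\<lambda>w. (E w ** M) $ i $ k"])
    show "(\<lambda>w. E (w + 2 * of_real pi * \<i>) $ i $ k) holomorphic_on UNIV"
      by (rule holomorphic_on_compose_gen
          [where f = "\<lambda>w. w + 2 * of_real pi * \<i>" and g = "\<lambda>w. E w $ i $ k" and t = UNIV, unfolded comp_def])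
        (auto intro!: holomorphic_intros E_holomorphic)
    show "(\<lambda>w. (E w ** M) $ i $ k) holomorphic_on UNIV"
      unfolding matrix_mult_nth by (intro holomorphic_intros E_holomorphic)
    show "{w. Re w < ln \<rho>} \<noteq> {}"
      using Re_l0 by blast
  qed (use near in \<open>auto intro: open_halfspace_Re_lt\<close>)
  then have "E (w + 2 * of_real pi * \<i>) = E w ** M" for w
    by (simp add: vec_eq_iff)
  with \<open>invertible M\<close> show thesis
    by (rule that)
qed

text \<open>The constant path and the circle are read with the same initial branch and both end at
  \<open>xj\<close>. So the value of \<open>H\<close> is the same, and only \<open>E\<close>
  changes, by the factor \<open>M\<close>.\<close>

lemma monodromy_generated_loop:
  assumes t: "t \<in> polydisc t0 \<delta>" and M: "\<And>w. E (w + 2 * of_real pi * \<i>) = E w ** M"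
  shows "monodromy Q x0 (generated_loop (t0 $ j) xj \<alpha>) t = M"
proof -
  interpret fuchsian_system Q t
    using t by (rule system)
  define l0 where "l0 = circle_log t 0"
  have l0: "exp l0 = xj - t $ j"
    using circle_log(2) [OF t, of 0] by (simp add: l0_def circle_from_def)
  have "xj \<in> ball (t $ j) \<rho> - {t $ j}"
    using circle_subset [OF t, of 0] by (simp add: circle_from_def)
  from loop_in_const [OF this]
  have "continued_solution Q x0 t (\<alpha> +++ (Fin \<circ> (\<lambda>_. xj))) = H (t $ j + exp l0) t ** E l0"
    using l0 by (intro representation [OF t, where l = "\<lambda>_. l0"]) (auto simp: l0_def loop_in_def)
  moreover have "continued_solution Q x0 t (\<alpha> +++ (Fin \<circ> (\<lambda>_. xj))) = continued_solution Q x0 t \<alpha>"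
    using continued_solution_join_const [of \<alpha> x0] \<alpha>_path \<alpha>_subset [OF t] by (simp add: comp_def)
  ultimately have out: "continued_solution Q x0 t \<alpha> = H xj t ** E l0"
    by (simp add: l0)
  have "continued_solution Q x0 t (\<alpha> +++ (Fin \<circ> circle_from (t0 $ j) xj)) =
      H (t $ j + exp (circle_log t 1)) t ** E (circle_log t 1)"
    using circle_loop [OF t] circle_log(1,2) [OF t]
    by (intro representation [OF t]) (auto simp: loop_in_def)
  also have "\<dots> = H xj t ** E l0 ** M"
    by (simp add: circle_log(5) [OF t] exp_add M matrix_mul_assoc l0 flip: l0_def)
  finally show ?thesis
    unfolding generated_loop_def
    using \<alpha>_path \<alpha>_subset [OF t] Fin_circle_loop [OF t] out
    by (intro continued_solution_lasso) auto
qed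

end

theorem theorem7p12:
  fixes D :: "(complex ^ 'n::finite) set"
    and Q :: "'n \<Rightarrow> complex ^ 'n \<Rightarrow> complex ^ 'k::finite ^ 'k"
    and x0 :: riemann_sphere
    and t0 :: "complex ^ 'n"
    and \<rho> \<delta> :: "'n \<Rightarrow> real"
    and xx :: "'n \<Rightarrow> complex"
    and \<theta> :: "'n \<Rightarrow> real"
    and \<alpha> :: "'n \<Rightarrow> real \<Rightarrow> riemann_sphere"
    and H :: "'n \<Rightarrow> complex \<Rightarrow> complex ^ 'n \<Rightarrow> complex ^ 'k ^ 'k"
    and E :: "'n \<Rightarrow> complex \<Rightarrow> complex ^ 'k ^ 'k"
  assumes "fuchsian_deformation D Q"
    and "t0 \<in> D"
    and "\<forall>j. Fin (t0 $ j) \<noteq> x0"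
    and "isoprincipal_wide_with D Q x0 t0 \<rho> \<delta> xx \<theta> \<alpha> H E"
  shows "(\<forall>j. \<exists>M. invertible M \<and>
            (\<forall>w. E j (w + 2 * of_real pi * \<i>) = E j w ** M) \<and>
            (\<forall>t\<in>polydisc t0 (\<delta> j).
               monodromy Q x0 (generated_loop (t0 $ j) (xx j) (\<alpha> j)) t = M)) \<and>
         (generates_fundamental_group (punctured_sphere t0) x0
            (range (\<lambda>j. generated_loop (t0 $ j) (xx j) (\<alpha> j))) \<longrightarrow>
          isomonodromic_at D Q x0 t0)"
proof -
  have iso: "isoprincipal_at_pole D Q x0 t0 j (\<rho> j) (\<delta> j) (xx j) (\<theta> j) (\<alpha> j) (H j) (E j)" for j
    using assms(1,4) by (simp add: isoprincipal_at_pole_def isoprincipal_wide_with_def)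
  define \<Gamma> where "\<Gamma> j = generated_loop (t0 $ j) (xx j) (\<alpha> j)" for j
  have "\<exists>M. invertible M \<and> (\<forall>w. E j (w + 2 * of_real pi * \<i>) = E j w ** M) \<and>
      (\<forall>t\<in>polydisc t0 (\<delta> j). monodromy Q x0 (\<Gamma> j) t = M)" for j
  proof -
    obtain M where "invertible M" "\<And>w. E j (w + 2 * of_real pi * \<i>) = E j w ** M"
      using isoprincipal_at_pole.E_periodic [OF iso [of j]] by auto
    then show ?thesis
      using isoprincipal_at_pole.monodromy_generated_loop [OF iso [of j]] unfolding \<Gamma>_def by blast
  qed
  then have part1: "\<forall>j. \<exists>M. invertible M \<and> (\<forall>w. E j (w + 2 * of_real pi * \<i>) = E j w ** M) \<and>
      (\<forall>t\<in>polydisc t0 (\<delta> j). monodromy Q x0 (\<Gamma> j) t = M)"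
    by blast
  \<comment> \<open>One radius at which the statements for all of the finitely many poles hold
    together.\<close>
  define d where "d = Min (range \<delta>)"
  have d: "d > 0" "d \<le> \<delta> j" for j
    using isoprincipal_at_pole.radii(2) [OF iso] by (auto simp: d_def)
  have centre: "t0 \<in> polydisc t0 d"
    using d(1) by (rule centre_in_polydisc)
  have sys: "fuchsian_system Q t" and loop: "loop_in (punctured_sphere t) x0 (\<Gamma> j)"
    and const: "monodromy Q x0 (\<Gamma> j) t = monodromy Q x0 (\<Gamma> j) t0"
    if "t \<in> polydisc t0 d" for t j
  proof -
    have t: "t \<in> polydisc t0 (\<delta> j)" "t0 \<in> polydisc t0 (\<delta> j)" for j
      using that centre polydisc_mono [OF d(2)] by blast+
    show "fuchsian_system Q t"
      using iso t(1) by (rule isoprincipal_at_pole.system)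
    show "loop_in (punctured_sphere t) x0 (\<Gamma> j)"
      unfolding \<Gamma>_def using iso t(1) by (rule isoprincipal_at_pole.generated_loop_loop_in)
    show "monodromy Q x0 (\<Gamma> j) t = monodromy Q x0 (\<Gamma> j) t0"
      using part1 t by metis
  qed
  have "isomonodromic_at D Q x0 t0"
    if gen: "generates_fundamental_group (punctured_sphere t0) x0 (range \<Gamma>)"
    unfolding isomonodromic_at_def
  proof (intro allI impI)
    fix \<gamma> assume \<gamma>: "loop_in (punctured_sphere t0) x0 \<gamma>"
    with gen obtain gs where gs: "set gs \<subseteq> range \<Gamma> \<union> reversepath ` range \<Gamma>"
      and hom: "homotopic_paths (punctured_sphere t0) \<gamma> (loop_product x0 gs)"
      unfolding generates_fundamental_group_def by blast
    obtain r where r: "r > 0"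
      "\<And>t. t \<in> polydisc t0 r \<Longrightarrow> homotopic_paths (punctured_sphere t) \<gamma> (loop_product x0 gs)"
      using hom by (rule homotopic_paths_punctured_sphere_nearby) blast
    \<comment> \<open>A generated loop starts at \<open>x0\<close> and avoids the poles of
      \<open>t\<close>; \<open>undefined\<close> stands for an arbitrary index.\<close>
    have x0: "x0 \<in> punctured_sphere t" if "t \<in> polydisc t0 d" for t
      using loop [OF that, of undefined] unfolding loop_in_def
      by (metis pathstart_in_path_image subsetD)
    have product: "monodromy Q x0 (loop_product x0 gs) t = monodromy Q x0 (loop_product x0 gs) t0"
      if t: "t \<in> polydisc t0 d" for t
    proof (rule monodromy_loop_product_cong)
      fix g assume "g \<in> set gs"
      then consider j where "g = \<Gamma> j" | j where "g = reversepath (\<Gamma> j)"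
        using gs by blast
      then show "loop_in (punctured_sphere t) x0 g \<and> loop_in (punctured_sphere t0) x0 g \<and>
          monodromy Q x0 g t = monodromy Q x0 g t0"
        using loop [OF t] loop [OF centre] const [OF t] sys [OF t] sys [OF centre]
        by cases (auto intro: loop_in_reversepath monodromy_reversepath_cong)
    qed (use sys x0 t centre in auto)
    have start: "pathstart \<gamma> = x0"
      using \<gamma> by (simp add: loop_in_def)
    show "\<exists>\<delta>>0. polydisc t0 \<delta> \<subseteq> D \<and> (\<forall>t\<in>polydisc t0 \<delta>.
        path_image \<gamma> \<subseteq> punctured_sphere t \<and> monodromy Q x0 \<gamma> t = monodromy Q x0 \<gamma> t0)"
    \<comment> \<open>Below \<open>d\<close> the generators keep their monodromy; below
      \<open>r\<close> the homotopy to their product avoids the poles.\<close>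
    proof (intro exI [of _ "min d r"] conjI ballI)
      show "min d r > 0"
        using d(1) r(1) by simp
      show "polydisc t0 (min d r) \<subseteq> D"
        using polydisc_mono [of "min d r" "\<delta> undefined"] d(2) [of undefined]
          isoprincipal_at_pole.polydisc_subset [OF iso] by (meson min.coboundedI1 order_trans)
      fix t assume "t \<in> polydisc t0 (min d r)"
      then have t: "t \<in> polydisc t0 d" "t \<in> polydisc t0 r"
        using polydisc_mono [of "min d r" d t0] polydisc_mono [of "min d r" r t0] by auto
      show "path_image \<gamma> \<subseteq> punctured_sphere t"
        using homotopic_paths_imp_subset [OF r(2) [OF t(2)]] by simp
      have "monodromy Q x0 \<gamma> t = monodromy Q x0 (loop_product x0 gs) t"
        using sys [OF t(1)] r(2) [OF t(2)] start
        by (rule fuchsian_system.continued_solution_homotopic)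
      also have "\<dots> = monodromy Q x0 (loop_product x0 gs) t0"
        using t(1) by (rule product)
      also have "\<dots> = monodromy Q x0 \<gamma> t0"
        using sys [OF centre] hom start
        by (rule fuchsian_system.continued_solution_homotopic [symmetric])
      finally show "monodromy Q x0 \<gamma> t = monodromy Q x0 \<gamma> t0" .
    qed
  qed
  with part1 show ?thesis
    unfolding \<Gamma>_def by blast
qed

end
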